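(* Fix an integer $M\ge1$ and a compact set of base points $y\in\mathbb{S}^2$. There exist $\rho_0>0$ and $C_M>0$ such that, for $U,W\in T_y\mathbb{S}^2$ with $|U|+|W|\le\rho_0$ and for $\lambda$ in any fixed bounded interval, the map $$G_y(U,W,\lambda):=\operatorname{Log}_y\!\left(\operatorname{SLERP}(\operatorname{Exp}_yU,\operatorname{Exp}_yW,\lambda)\right)$$ has the finite expansion $$G_y(U,W,\lambda)=(1-\lambda)U+\lambda W+\sum_{r=3}^{M}\mathcal{G}_r(y;U,W,\lambda)+\mathcal{R}_{M+1}(y;U,W,\lambda),$$ where each $\mathcal{G}_r$ is homogeneous of degree $r$ in $(U,W)$, smooth in $y$, and smooth in $\lambda$. For bounded $\lambda$, the remainder satisfies $$|\mathcal{R}_{M+1}(y;U,W,\lambda)|\le C_M(|U|+|W|)^{M+1}.$$ Moreover, there is no quadratic term in the expansion.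
   Context: $\mathbb{S}^2=\{x\in\mathbb{R}^3:|x|=1\}$ with the induced Riemannian metric; $T_y\mathbb{S}^2=\{v\in\mathbb{R}^3:v\cdot y=0\}$. $\operatorname{Exp}_y(v)=\cos|v|\,y+\frac{\sin|v|}{|v|}v$ for $v\in T_y\mathbb{S}^2$ (with $\operatorname{Exp}_y(0)=y$). For $z$ not antipodal to $y$ and $\alpha=\arccos(y\cdot z)$, $\operatorname{Log}_y(z)=\frac{\alpha}{\sin\alpha}(z-(y\cdot z)y)\in T_y\mathbb{S}^2$ (with $\operatorname{Log}_y(y)=0$). For non-antipodal $a,b\in\mathbb{S}^2$ and any real $\lambda$, $\operatorname{SLERP}(a,b,\lambda)=\operatorname{Exp}_a(\lambda\operatorname{Log}_a b)$, equivalently $\frac{\sin((1-\lambda)\alpha)}{\sin\alpha}a+\frac{\sin(\lambda\alpha)}{\sin\alpha}b$ with $\alpha=\arccos(a\cdot b)\in(0,\pi)$. The constants $\rho_0$ and $C_M$ may depend on the chosen bounded $\lambda$-interval. An empty sum is zero. *)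

theory Defs
  imports "HOL-Analysis.Analysis"
begin

abbreviation S2 :: "(real^3) set" where
  "S2 \<equiv> sphere 0 1"

definition tangent_S2 :: "real^3 \<Rightarrow> (real^3) set" where
  "tangent_S2 y = {v. v \<bullet> y = 0}"

definition Exp_S2 :: "real^3 \<Rightarrow> real^3 \<Rightarrow> real^3" where
  "Exp_S2 y v =
     (if v = 0 then y else cos (norm v) *\<^sub>R y + (sin (norm v) / norm v) *\<^sub>R v)"

text \<open>The value at the antipode \<open>z = - y\<close> is a junk value.\<close>

definition Log_S2 :: "real^3 \<Rightarrow> real^3 \<Rightarrow> real^3" where
  "Log_S2 y z =
     (if z = y then 0
      else (arccos (y \<bullet> z) / sin (arccos (y \<bullet> z))) *\<^sub>R (z - (y \<bullet> z) *\<^sub>R y))"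

text \<open>Meaningful only for non-antipodal \<open>a\<close> and \<open>b\<close>.\<close>

definition SLERP :: "real^3 \<Rightarrow> real^3 \<Rightarrow> real \<Rightarrow> real^3" where
  "SLERP a b l = Exp_S2 a (l *\<^sub>R Log_S2 a b)"

definition G_S2 :: "real^3 \<Rightarrow> real^3 \<Rightarrow> real^3 \<Rightarrow> real \<Rightarrow> real^3" where
  "G_S2 y U W l = Log_S2 y (SLERP (Exp_S2 y U) (Exp_S2 y W) l)"

definition G_S2_defined :: "real^3 \<Rightarrow> real^3 \<Rightarrow> real^3 \<Rightarrow> real \<Rightarrow> bool" where
  "G_S2_defined y U W l \<longleftrightarrow>
     Exp_S2 y W \<noteq> - Exp_S2 y U \<and> SLERP (Exp_S2 y U) (Exp_S2 y W) l \<noteq> - y"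

text \<open>Class \<open>C\<^sup>k\<close>, by iterated directional derivatives. Intended for open \<open>T\<close> and
  finite-dimensional domains, where it is the usual notion.\<close>

primrec Ck_on :: "nat \<Rightarrow> 'a::euclidean_space set \<Rightarrow> ('a \<Rightarrow> 'b::real_normed_vector) \<Rightarrow> bool" where
  "Ck_on 0 T f \<longleftrightarrow> continuous_on T f"
| "Ck_on (Suc k) T f \<longleftrightarrow>
     (\<forall>x\<in>T. f differentiable (at x)) \<and>
     (\<forall>v. Ck_on k T (\<lambda>x. frechet_derivative f (at x) v))"

text \<open>Smoothness on an arbitrary subset of a Euclidean space: local existence of smooth
  extensions to open sets. On an embedded submanifold this is the intrinsic notion.\<close>

definition smooth_on :: "'a::euclidean_space set \<Rightarrow> ('a \<Rightarrow> 'b::real_normed_vector) \<Rightarrow> bool" where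
  "smooth_on A f \<longleftrightarrow>
     (\<forall>x\<in>A. \<exists>T g. open T \<and> x \<in> T \<and> (\<forall>k. Ck_on k T g) \<and> (\<forall>z\<in>A \<inter> T. g z = f z))"

text \<open>The fibres \<open>T\<^sub>y S\<^sup>2\<close> vary with \<open>y\<close>, so smoothness in \<open>y\<close> of a map of
  \<open>(y; U, W, \<lambda>)\<close> with \<open>U, W \<in> T\<^sub>y S\<^sup>2\<close> is smoothness on the total space
  \<open>(TS\<^sup>2 \<oplus> TS\<^sup>2) \<times> \<real>\<close>, an embedded submanifold of the ambient Euclidean space.\<close>

definition tangent_pairs :: "((real^3) \<times> (real^3) \<times> (real^3) \<times> real) set" where
  "tangent_pairs = {(y, U, W, l). y \<in> S2 \<and> U \<in> tangent_S2 y \<and> W \<in> tangent_S2 y}"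

definition homogeneous_at :: "nat \<Rightarrow> real^3 \<Rightarrow> (real^3 \<Rightarrow> real^3 \<Rightarrow> real^3) \<Rightarrow> bool" where
  "homogeneous_at r y H \<longleftrightarrow>
     (\<forall>t::real. \<forall>U\<in>tangent_S2 y. \<forall>W\<in>tangent_S2 y.
        H (t *\<^sub>R U) (t *\<^sub>R W) = t ^ r *\<^sub>R H U W)"

text \<open>\<open>Q\<close> is the degree-two term of the expansion of \<open>G_S2 y U W l\<close> at \<open>(U, W) = (0, 0)\<close>.\<close>

definition quadratic_term :: "real^3 \<Rightarrow> real \<Rightarrow> (real^3 \<Rightarrow> real^3 \<Rightarrow> real^3) \<Rightarrow> bool" where
  "quadratic_term y l Q \<longleftrightarrow>
     homogeneous_at 2 y Q \<and>
     (\<exists>\<rho>>0. \<exists>C. \<forall>U\<in>tangent_S2 y. \<forall>W\<in>tangent_S2 y. norm U + norm W \<le> \<rho> \<longrightarrow>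
        norm (G_S2 y U W l - ((1 - l) *\<^sub>R U + l *\<^sub>R W + Q U W)) \<le> C * (norm U + norm W) ^ 3)"

end

theory Submission
  imports Defs "HOL-Library.Landau_Symbols"
begin

text \<open>Both the spherical interpolation of \<open>Exp\<^sub>y U\<close>, \<open>Exp\<^sub>y W\<close> and its logarithm at \<open>y\<close> stay in the span
  of \<open>y, U, W\<close>, so \<open>G\<^sub>y(U, W, \<lambda>) = a U + b W\<close> with scalars \<open>a, b\<close> that depend only on
  \<open>|U|\<^sup>2, |W|\<^sup>2, U \<bullet> W\<close> and \<open>\<lambda>\<close>, not on \<open>y\<close>. They are built from \<open>cos t\<close>, \<open>sin t / t\<close> and
  \<open>(arccos d)\<^sup>2\<close>, which have Taylor expansions in \<open>t\<^sup>2\<close> at \<open>0\<close> and in \<open>1 - d\<close> at \<open>0\<close>. Hence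
  \<open>a\<close> and \<open>b\<close> expand into polynomials of even degree in \<open>(U, W)\<close> with constant terms
  \<open>1 - \<lambda>\<close> and \<open>\<lambda>\<close>, and \<open>G\<^sub>y\<close> into polynomials of odd degree; in particular the quadratic term vanishes.\<close>

section \<open>Polynomial maps are smooth\<close>

text \<open>Structural induction with the sum and product rules. The derivative is carried as a
  witness \<open>f'\<close>, so that differentiability and polynomiality in the base point are
  proved together.\<close>

lemma real_polynomial_function_directional_derivative:
  fixes f :: "'a::euclidean_space \<Rightarrow> real"
  assumes "real_polynomial_function f"
  shows "\<exists>f'. (\<forall>x. (f has_derivative f' x) (at x)) \<and>
    (\<forall>v. real_polynomial_function (\<lambda>x. f' x v))"
  using assms
proof induction
  case (linear f)
  then show ?case
    by (intro exI[of _ "\<lambda>x. f"])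
      (auto intro: bounded_linear.has_derivative[OF linear has_derivative_ident, simplified])
next
  case (const c)
  then show ?case by (intro exI[of _ "\<lambda>x h. 0"]) auto
next
  case (add f g)
  then obtain f' g' where "\<forall>x. (f has_derivative f' x) (at x)" "\<forall>x. (g has_derivative g' x) (at x)"
    "\<forall>v. real_polynomial_function (\<lambda>x. f' x v)" "\<forall>v. real_polynomial_function (\<lambda>x. g' x v)"
    by blast
  then show ?case
    by (intro exI[of _ "\<lambda>x h. f' x h + g' x h"]) (auto intro!: has_derivative_add real_polynomial_function.intros(3))
next
  case (mult f g)
  then obtain f' g' where "\<forall>x. (f has_derivative f' x) (at x)" "\<forall>x. (g has_derivative g' x) (at x)"
    "\<forall>v. real_polynomial_function (\<lambda>x. f' x v)" "\<forall>v. real_polynomial_function (\<lambda>x. g' x v)"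
    by blast
  then show ?case
    using mult.hyps
    by (intro exI[of _ "\<lambda>x h. f x * g' x h + f' x h * g x"])
      (auto intro!: has_derivative_mult real_polynomial_function.intros(3) real_polynomial_function.intros(4))
qed

lemma frechet_derivative_inner_const:
  assumes "f differentiable at x"
  shows "frechet_derivative f (at x) v \<bullet> b = frechet_derivative (\<lambda>x. f x \<bullet> b) (at x) v"
proof -
  have "((\<lambda>x. f x \<bullet> b) has_derivative (\<lambda>v. frechet_derivative f (at x) v \<bullet> b)) (at x)"
    using assms by (intro has_derivative_inner_left) (simp add: frechet_derivative_works)
  from frechet_derivative_at[OF this] show ?thesis by metis
qed

text \<open>Taking inner products with basis vectors commutes with differentiation, which reduces
  the claim to the scalar case.\<close>

lemma polynomial_function_directional_derivative:
  fixes f :: "'a::euclidean_space \<Rightarrow> 'b::euclidean_space"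
  assumes "polynomial_function f"
  shows "polynomial_function (\<lambda>x. frechet_derivative f (at x) v)"
  unfolding polynomial_function_iff_Basis_inner
proof
  fix b :: 'b assume b: "b \<in> Basis"
  have "real_polynomial_function (\<lambda>x. f x \<bullet> b)"
    using assms b by (simp add: polynomial_function_iff_Basis_inner)
  from real_polynomial_function_directional_derivative[OF this] obtain f' where
    "\<And>x. ((\<lambda>x. f x \<bullet> b) has_derivative f' x) (at x)" "real_polynomial_function (\<lambda>x. f' x v)"
    by blast
  moreover from this(1) have "frechet_derivative (\<lambda>x. f x \<bullet> b) (at x) = f' x" for x
    by (metis frechet_derivative_at)
  ultimately show "real_polynomial_function (\<lambda>x. frechet_derivative f (at x) v \<bullet> b)"
    by (simp add: frechet_derivative_inner_const differentiable_at_polynomial_function assms)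
qed

text \<open>Directional derivatives of polynomials are again polynomials, so the induction on
  \<open>k\<close> runs with \<open>f\<close> arbitrary.\<close>

lemma Ck_on_polynomial_function:
  fixes f :: "'a::euclidean_space \<Rightarrow> 'b::euclidean_space"
  shows "polynomial_function f \<Longrightarrow> Ck_on k T f"
proof (induction k arbitrary: f)
  case 0
  then show ?case by (simp add: continuous_on_polymonial_function)
next
  case (Suc k)
  then show ?case
    by (simp add: differentiable_at_polynomial_function polynomial_function_directional_derivative)
qed

lemma smooth_on_polynomial_function:
  fixes f :: "'a::euclidean_space \<Rightarrow> 'b::euclidean_space"
  assumes "polynomial_function f"
  shows "smooth_on A f"
  unfolding smooth_on_def
  by (intro ballI exI[of _ UNIV] exI[of _ f]) (simp add: Ck_on_polynomial_function assms)

section \<open>Orders of vanishing at the origin, uniform for bounded \<lambda>\<close>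

text \<open>The base point \<open>y\<close> is absent because the scalar coefficients of
  \<open>U\<close> and \<open>W\<close> do not depend on it; this makes all later estimates uniform
  in \<open>y\<close>.\<close>

type_synonym param = "(real^3) \<times> (real^3) \<times> real"

definition pair_size :: "param \<Rightarrow> real" where
  "pair_size = (\<lambda>(U, W, l). norm U + norm W)"

text \<open>Convergence of \<open>(U, W)\<close> to 0, uniform over \<lambda> in a bounded range.
  With \<open>nhds\<close> in place of a punctured filter, the points \<open>(0, 0, l)\<close> are
  included, so an eventual estimate can be evaluated at the origin itself.\<close>

definition origin_filter :: "real \<Rightarrow> param filter" where
  "origin_filter \<Lambda> = inf (filtercomap pair_size (nhds 0)) (principal {(U, W, l). \<bar>l\<bar> \<le> \<Lambda>})"

lemma pair_size_nonneg [simp]: "0 \<le> pair_size x"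
  by (auto simp: pair_size_def split: prod.split)

lemma eventually_origin_filter:
  "eventually P (origin_filter \<Lambda>) \<longleftrightarrow>
    (\<exists>\<rho>>0. \<forall>U W l. \<bar>l\<bar> \<le> \<Lambda> \<longrightarrow> norm U + norm W \<le> \<rho> \<longrightarrow> P (U, W, l))"
proof
  assume "eventually P (origin_filter \<Lambda>)"
  then obtain Q where Q: "eventually Q (nhds (0::real))"
    and P: "\<And>U W l. Q (norm U + norm W) \<Longrightarrow> \<bar>l\<bar> \<le> \<Lambda> \<Longrightarrow> P (U, W, l)"
    by (auto simp: origin_filter_def eventually_inf_principal eventually_filtercomap pair_size_def)
  from Q obtain d where d: "d > 0" "\<And>t. \<bar>t\<bar> < d \<Longrightarrow> Q t"
    by (auto simp: eventually_nhds_metric dist_real_def)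
  show "\<exists>\<rho>>0. \<forall>U W l. \<bar>l\<bar> \<le> \<Lambda> \<longrightarrow> norm U + norm W \<le> \<rho> \<longrightarrow> P (U, W, l)"
    \<comment> \<open>Halving passes from the open ball of radius \<open>d\<close> to a closed
      one.\<close>
    by (rule exI[of _ "d / 2"]) (use d P in force)
next
  assume "\<exists>\<rho>>0. \<forall>U W l. \<bar>l\<bar> \<le> \<Lambda> \<longrightarrow> norm U + norm W \<le> \<rho> \<longrightarrow> P (U, W, l)"
  then obtain \<rho> where \<rho>: "\<rho> > 0" "\<And>U W l. \<bar>l\<bar> \<le> \<Lambda> \<Longrightarrow> norm U + norm W \<le> \<rho> \<Longrightarrow> P (U, W, l)"
    by blast
  have "eventually (\<lambda>t. t \<le> \<rho>) (nhds (0::real))"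
    using \<rho>(1) by (auto simp: eventually_nhds_metric dist_real_def intro!: exI[of _ \<rho>])
  then show "eventually P (origin_filter \<Lambda>)"
    unfolding origin_filter_def eventually_inf_principal eventually_filtercomap
    by (rule exI[of _ "\<lambda>t. t \<le> \<rho>", OF conjI]) (auto simp: pair_size_def intro: \<rho>(2))
qed

lemma eventually_pair_size_le_1: "eventually (\<lambda>x. pair_size x \<le> 1) (origin_filter \<Lambda>)"
  unfolding eventually_origin_filter by (intro exI[of _ 1]) (simp add: pair_size_def)

text \<open>The index counts pairs of degrees, since every scalar involved is even in
  \<open>(U, W)\<close>. The implied constant may depend on the \<lambda>-range, so powers of
  \<lambda> count as order 0.\<close>

definition small :: "nat \<Rightarrow> (param \<Rightarrow> real) \<Rightarrow> bool" where
  "small m f \<longleftrightarrow> (\<forall>\<Lambda>. f \<in> O[origin_filter \<Lambda>](\<lambda>x. pair_size x ^ (2 * m)))"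

lemma small_mono: "small n f" if "small m f" "n \<le> m"
proof -
  have "(\<lambda>x. pair_size x ^ (2 * m)) \<in> O[origin_filter \<Lambda>](\<lambda>x. pair_size x ^ (2 * n))" for \<Lambda>
  proof (rule landau_o.bigI[of 1])
    show "eventually (\<lambda>x. norm (pair_size x ^ (2 * m)) \<le> 1 * norm (pair_size x ^ (2 * n))) (origin_filter \<Lambda>)"
      using eventually_pair_size_le_1
      by eventually_elim (use that(2) in \<open>simp add: power_decreasing\<close>)
  qed simp
  then show ?thesis
    using that(1) unfolding small_def by (meson landau_o.big_trans)
qed

lemma small_add: "small m f \<Longrightarrow> small m g \<Longrightarrow> small m (\<lambda>x. f x + g x)"
  and small_diff: "small m f \<Longrightarrow> small m g \<Longrightarrow> small m (\<lambda>x. f x - g x)"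
  by (simp_all add: small_def sum_in_bigo)

lemma small_mult: "small m f \<Longrightarrow> small n g \<Longrightarrow> small (m + n) (\<lambda>x. f x * g x)"
  by (simp add: small_def power_add distrib_left landau_o.big.mult)

lemma small_zero [simp]: "small m (\<lambda>x. 0)"
  by (simp add: small_def)

lemma small_const: "small 0 (\<lambda>x. c)"
  by (simp add: small_def)

lemma small_power: "small m f \<Longrightarrow> small (m * k) (\<lambda>x. f x ^ k)"
proof (induction k)
  case (Suc k)
  then show ?case using small_mult[of m f "m * k" "\<lambda>x. f x ^ k"] by simp
qed (simp add: small_const)

lemma small_bound:
  assumes "small m f" "\<And>\<Lambda>. eventually (\<lambda>x. \<bar>g x\<bar> \<le> C * \<bar>f x\<bar>) (origin_filter \<Lambda>)"
  shows "small m g"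
proof -
  have "g \<in> O[origin_filter \<Lambda>](f)" for \<Lambda>
    using assms(2) by (intro bigoI[of _ C]) simp
  then show ?thesis
    using assms(1) unfolding small_def by (meson landau_o.big_trans)
qed

lemma small_tendsto:
  assumes "small m f" "m \<ge> 1" shows "(f \<longlongrightarrow> 0) (origin_filter \<Lambda>)"
proof -
  have "filterlim pair_size (nhds 0) (origin_filter \<Lambda>)"
    unfolding origin_filter_def
    by (rule filterlim_mono[OF filterlim_filtercomap order_refl inf_le1])
  then have lim: "((\<lambda>x. pair_size x ^ 2) \<longlongrightarrow> 0) (origin_filter \<Lambda>)"
    using tendsto_power[of pair_size 0 _ 2] by simp
  have "f \<in> O[origin_filter \<Lambda>](\<lambda>x. pair_size x ^ 2)"
    using small_mono[OF assms] by (simp add: small_def)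
  then obtain c where c: "eventually (\<lambda>x. norm (f x) \<le> c * norm (pair_size x ^ 2)) (origin_filter \<Lambda>)"
    by (elim landau_o.bigE)
  show ?thesis
    by (rule Lim_null_comparison[OF c]) (use tendsto_mult_left[OF lim, of c] in simp)
qed

section \<open>Polynomials homogeneous of even degree in \<open>(U, W)\<close>\<close>

definition homog_poly :: "nat \<Rightarrow> (param \<Rightarrow> real) \<Rightarrow> bool" where
  "homog_poly k f \<longleftrightarrow> real_polynomial_function f \<and>
     (\<forall>t U W l. f (t *\<^sub>R U, t *\<^sub>R W, l) = t ^ (2 * k) * f (U, W, l))"

lemma homog_polyD:
  "homog_poly k f \<Longrightarrow> f (t *\<^sub>R U, t *\<^sub>R W, l) = t ^ (2 * k) * f (U, W, l)"
  by (simp add: homog_poly_def)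

text \<open>Homogeneity at scaling factor 0, where \<open>0 ^ 0 = 1\<close>.\<close>

lemma homog_poly_0: "homog_poly 0 f \<Longrightarrow> f x = f (0, 0, snd (snd x))"
  using homog_polyD[of 0 f 0 "fst x" "fst (snd x)" "snd (snd x)"] by simp

lemma homog_poly_vanishes: "homog_poly k f \<Longrightarrow> k \<ge> 1 \<Longrightarrow> f (0, 0, l) = 0"
  using homog_polyD[of k f 0 0 0 l] by (simp add: power_0_left)

lemma homog_poly_zero [simp]: "homog_poly k (\<lambda>x. 0)"
  by (auto simp: homog_poly_def)

lemma homog_poly_const: "homog_poly 0 (\<lambda>x. c)"
  by (auto simp: homog_poly_def)

lemma homog_poly_add: "homog_poly k f \<Longrightarrow> homog_poly k g \<Longrightarrow> homog_poly k (\<lambda>x. f x + g x)"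
  by (auto simp: homog_poly_def algebra_simps)

lemma homog_poly_mult: "homog_poly j f \<Longrightarrow> homog_poly k g \<Longrightarrow> homog_poly (j + k) (\<lambda>x. f x * g x)"
  by (auto simp: homog_poly_def power_add distrib_left)

lemma real_polynomial_function_inner:
  assumes "bounded_linear f" "bounded_linear g"
  shows "real_polynomial_function (\<lambda>x. (f x :: 'b::euclidean_space) \<bullet> g x)"
proof -
  have "real_polynomial_function (\<lambda>x. \<Sum>b\<in>Basis. (f x \<bullet> b) * (g x \<bullet> b))"
    using assms
    by (intro real_polynomial_function_sum real_polynomial_function.intros(1,4) finite_Basis
        bounded_linear_compose[OF bounded_linear_inner_left])
  then show ?thesis by (simp add: euclidean_inner[symmetric])
qed

lemma bounded_linear_param_components:
  "bounded_linear (\<lambda>(U, W, l). U)" "bounded_linear (\<lambda>(U, W, l). W)" "bounded_linear (\<lambda>(U, W, l). l)"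
  by (auto simp: split_def intro: bounded_linear_fst bounded_linear_compose[OF bounded_linear_fst bounded_linear_snd]
    bounded_linear_compose[OF bounded_linear_snd bounded_linear_snd])

lemma homog_poly_inner:
  "homog_poly 1 (\<lambda>(U, W, l). U \<bullet> U)" "homog_poly 1 (\<lambda>(U, W, l). W \<bullet> W)"
  "homog_poly 1 (\<lambda>(U, W, l). U \<bullet> W)"
  using real_polynomial_function_inner[OF bounded_linear_param_components(1) bounded_linear_param_components(1)]
    real_polynomial_function_inner[OF bounded_linear_param_components(2) bounded_linear_param_components(2)]
    real_polynomial_function_inner[OF bounded_linear_param_components(1) bounded_linear_param_components(2)]
  by (auto simp: homog_poly_def split_def power2_eq_square)

lemma homog_poly_parameter: "homog_poly 0 (\<lambda>(U, W, l). l)"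
  using bounded_linear_param_components(3) by (auto simp: homog_poly_def)

text \<open>Continuity bounds \<open>f\<close> on a compact set containing all pairs of size 1, and
  homogeneity carries that bound to every other size.\<close>

lemma small_homog_poly:
  assumes "homog_poly k f" shows "small k f"
  unfolding small_def
proof
  fix \<Lambda> :: real
  let ?D = "cball 0 1 \<times> cball 0 1 \<times> cball 0 \<bar>\<Lambda>\<bar> :: param set"
  have "continuous_on ?D f"
    using assms by (simp add: homog_poly_def continuous_on_polymonial_function real_polynomial_function_eq)
  then have "bounded (f ` ?D)"
    by (intro compact_imp_bounded compact_continuous_image compact_Times compact_cball)
  then obtain C where C: "\<And>x. x \<in> ?D \<Longrightarrow> \<bar>f x\<bar> \<le> C"
    by (auto simp: bounded_iff)
  have "\<bar>f (U, W, l)\<bar> \<le> C * (norm U + norm W) ^ (2 * k)" if l: "\<bar>l\<bar> \<le> \<Lambda>" for U W l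
  proof (cases "norm U + norm W = 0")
    case True
    \<comment> \<open>No rescaling is possible here. For \<open>k = 0\<close> the right-hand side is
      \<open>C\<close>, because \<open>0 ^ 0 = 1\<close>; for \<open>k > 0\<close> both sides
      vanish.\<close>
    then have *: "U = 0" "W = 0" by (simp_all add: add_nonneg_eq_0_iff)
    have "\<bar>f (0, 0, l)\<bar> \<le> C" by (rule C) (use l in auto)
    then show ?thesis
      using homog_poly_vanishes[OF assms, of l] * by (cases "k = 0") auto
  next
    case False
    define s where "s = norm U + norm W"
    have s: "s > 0" using False by (simp add: s_def less_le)
    have "\<bar>f (inverse s *\<^sub>R U, inverse s *\<^sub>R W, l)\<bar> \<le> C"
      by (rule C) (use l s in \<open>auto simp: s_def field_simps\<close>)
    moreover have "f (U, W, l) = s ^ (2 * k) * f (inverse s *\<^sub>R U, inverse s *\<^sub>R W, l)"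
      using homog_polyD[OF assms, of s "inverse s *\<^sub>R U" "inverse s *\<^sub>R W" l] s by simp
    ultimately show ?thesis
      using s by (simp add: abs_mult s_def[symmetric] mult.commute mult_left_mono)
  qed
  then have "\<forall>U W l. \<bar>l\<bar> \<le> \<Lambda> \<longrightarrow> norm U + norm W \<le> 1 \<longrightarrow>
      norm (f (U, W, l)) \<le> C * norm (pair_size (U, W, l) ^ (2 * k))"
    by (simp add: pair_size_def)
  then show "f \<in> O[origin_filter \<Lambda>](\<lambda>x. pair_size x ^ (2 * k))"
    by (intro bigoI[of _ C]) (auto simp: eventually_origin_filter intro: exI[of _ 1])
qed

text \<open>Finite sums of homogeneous pieces, encoded inductively so that closure under products
  needs no bookkeeping of degrees.\<close>

inductive even_poly :: "(param \<Rightarrow> real) \<Rightarrow> bool" where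
  homog: "homog_poly k f \<Longrightarrow> even_poly f"
| add: "even_poly f \<Longrightarrow> even_poly g \<Longrightarrow> even_poly (\<lambda>x. f x + g x)"

lemma even_poly_mult: "even_poly f \<Longrightarrow> even_poly g \<Longrightarrow> even_poly (\<lambda>x. f x * g x)"
proof (induction rule: even_poly.induct)
  case (homog k f)
  from homog(2) show ?case
  proof induction
    case (homog j g)
    then show ?case using \<open>homog_poly k f\<close> by (blast intro: even_poly.homog homog_poly_mult)
  next
    case (add g h)
    then show ?case by (simp add: distrib_left even_poly.add)
  qed
next
  case (add f h)
  then show ?case by (simp add: distrib_right even_poly.add)
qed

lemma small_0_even_poly: "even_poly f \<Longrightarrow> small 0 f"
  by (induction rule: even_poly.induct) (auto intro: small_add small_mono[OF small_homog_poly])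

text \<open>Pieces of degree 0 cancel against their value at the origin; all others vanish there and
  have degree at least 2.\<close>

lemma small_1_even_poly: "even_poly f \<Longrightarrow> small 1 (\<lambda>(U, W, l). f (U, W, l) - f (0, 0, l))"
proof (induction rule: even_poly.induct)
  case (homog k f)
  show ?case
  proof (cases "k = 0")
    case True
    then have "(\<lambda>x. f x - f (0, 0, snd (snd x))) = (\<lambda>x. 0)"
      using homog_poly_0 homog by fastforce
    then show ?thesis by (simp add: split_def)
  next
    case False
    then show ?thesis
      using homog small_mono[OF small_homog_poly[OF homog], of 1]
      by (simp add: homog_poly_vanishes split_def)
  qed
next
  case (add f g)
  from small_add[OF add.IH] show ?case by (simp add: split_def algebra_simps)
qed

text \<open>A piece of index below \<open>n\<close> goes into the slot of its degree; a piece of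
  index at least \<open>n\<close> is left to the remainder.\<close>

lemma even_poly_graded:
  assumes "even_poly f"
  shows "\<exists>g. (\<forall>k. homog_poly k (g k)) \<and> small n (\<lambda>x. f x - (\<Sum>k<n. g k x))"
  using assms
proof induction
  case (homog j f)
  have "small n (\<lambda>x. f x - (\<Sum>k<n. if k = j then f x else 0))"
  proof (cases "j < n")
    case False
    then show ?thesis using small_mono[OF small_homog_poly[OF homog], of n] by simp
  qed simp
  moreover have "homog_poly k (\<lambda>x. if k = j then f x else 0)" for k
    using homog by (cases "k = j") auto
  ultimately show ?case
    by (intro exI[of _ "\<lambda>k x. if k = j then f x else 0"]) blast
next
  case (add f h)
  then obtain g1 g2 where "\<forall>k. homog_poly k (g1 k)" "small n (\<lambda>x. f x - (\<Sum>k<n. g1 k x))"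
    "\<forall>k. homog_poly k (g2 k)" "small n (\<lambda>x. h x - (\<Sum>k<n. g2 k x))"
    by blast
  then show ?case
    using small_add[of n "\<lambda>x. f x - (\<Sum>k<n. g1 k x)" "\<lambda>x. h x - (\<Sum>k<n. g2 k x)"]
    by (intro exI[of _ "\<lambda>k x. g1 k x + g2 k x"])
      (auto simp: sum.distrib algebra_simps intro: homog_poly_add)
qed

section \<open>Calculus of even Taylor expansions\<close>

text \<open>The degree of \<open>p\<close> is not restricted, so products need no truncation;
  sorting by degree is postponed to \<open>even_poly_graded\<close>.\<close>

definition expands :: "nat \<Rightarrow> (param \<Rightarrow> real) \<Rightarrow> bool" where
  "expands n f \<longleftrightarrow> (\<exists>p. even_poly p \<and> small n (\<lambda>x. f x - p x))"

lemma expands_even_poly: "even_poly p \<Longrightarrow> expands n p"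
  unfolding expands_def by (intro exI[of _ p]) simp

lemma expands_homog_poly: "homog_poly k p \<Longrightarrow> expands n p"
  by (intro expands_even_poly even_poly.homog)

lemmas expands_const = expands_homog_poly[OF homog_poly_const]
lemmas expands_inner = expands_homog_poly[OF homog_poly_inner(1)]
  expands_homog_poly[OF homog_poly_inner(2)] expands_homog_poly[OF homog_poly_inner(3)]
lemmas expands_parameter = expands_homog_poly[OF homog_poly_parameter]

lemma expands_small: "small n f \<Longrightarrow> expands n f"
  unfolding expands_def using even_poly.homog[OF homog_poly_const[of 0]] by (intro exI[of _ "\<lambda>x. 0"]) simp

lemma expands_add: 
  assumes "expands n f" "expands n g" shows "expands n (\<lambda>x. f x + g x)"
proof -
  obtain p q where "even_poly p" "small n (\<lambda>x. f x - p x)" "even_poly q" "small n (\<lambda>x. g x - q x)"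
    using assms by (auto simp: expands_def)
  then show ?thesis
    unfolding expands_def using small_add[of n "\<lambda>x. f x - p x" "\<lambda>x. g x - q x"]
    by (intro exI[of _ "\<lambda>x. p x + q x"]) (auto simp: algebra_simps intro: even_poly.add)
qed

lemma expands_imp_small_0:
  assumes "expands n f" shows "small 0 f"
proof -
  obtain p where "even_poly p" "small n (\<lambda>x. f x - p x)"
    using assms by (auto simp: expands_def)
  then show ?thesis
    using small_add[OF small_mono[of n "\<lambda>x. f x - p x" 0] small_0_even_poly[of p]] by simp
qed

lemma expands_mult:
  assumes "expands n f" "expands n g" shows "expands n (\<lambda>x. f x * g x)"
proof -
  obtain p q where p: "even_poly p" "small n (\<lambda>x. f x - p x)" and q: "even_poly q" "small n (\<lambda>x. g x - q x)"
    using assms by (auto simp: expands_def)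
  \<comment> \<open>This telescoped sum is \<open>f x * g x - p x * q x\<close>.\<close>
  have "small n (\<lambda>x. f x * (g x - q x) + q x * (f x - p x))"
    using small_mult[OF expands_imp_small_0[OF assms(1)] q(2)]
      small_mult[OF small_0_even_poly[OF q(1)] p(2)]
    by (intro small_add) simp_all
  then show ?thesis
    unfolding expands_def using even_poly_mult[OF p(1) q(1)]
    by (intro exI[of _ "\<lambda>x. p x * q x"]) (auto simp: algebra_simps)
qed

lemma expands_diff: "expands n f \<Longrightarrow> expands n g \<Longrightarrow> expands n (\<lambda>x. f x - g x)"
  using expands_add[OF _ expands_mult[OF expands_const[of n "-1"]], of f g] by simp

lemma expands_power: "expands n f \<Longrightarrow> expands n (\<lambda>x. f x ^ k)"
  by (induction k) (auto intro: expands_const expands_mult)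

lemma expands_sum: "(\<And>i. i \<in> I \<Longrightarrow> expands n (f i)) \<Longrightarrow> expands n (\<lambda>x. \<Sum>i\<in>I. f i x)"
  by (induction I rule: infinite_finite_induct) (auto intro: expands_const expands_add)

text \<open>The error estimate holds at the origin, where its right-hand side is 0. Hence the
  approximating polynomial has no constant term either, and then it has order at least 2.\<close>

lemma expands_vanishing_imp_small_1:
  assumes "expands n f" "n \<ge> 1" "\<And>l. f (0, 0, l) = 0"
  shows "small 1 f"
proof -
  obtain p where p: "even_poly p" "small n (\<lambda>x. f x - p x)"
    using assms by (auto simp: expands_def)
  have fp: "small 1 (\<lambda>x. f x - p x)" using small_mono[OF p(2) assms(2)] .
  have "p (0, 0, l) = 0" for l
  proof -
    have "(\<lambda>x. f x - p x) \<in> O[origin_filter \<bar>l\<bar>](\<lambda>x. pair_size x ^ 2)"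
      using fp by (simp add: small_def)
    then obtain c where "eventually (\<lambda>x. norm (f x - p x) \<le> c * norm (pair_size x ^ 2)) (origin_filter \<bar>l\<bar>)"
      by (elim landau_o.bigE)
    then obtain \<rho> where "\<rho> > 0" and \<rho>: "\<And>U W k. \<bar>k\<bar> \<le> \<bar>l\<bar> \<Longrightarrow> norm U + norm W \<le> \<rho> \<Longrightarrow>
        norm (f (U, W, k) - p (U, W, k)) \<le> c * norm (pair_size (U, W, k) ^ 2)"
      unfolding eventually_origin_filter by blast
    then show ?thesis
      using assms(3)[of l] \<rho>[of l 0 0] by (simp add: pair_size_def)
  qed
  then have "small 1 p" using small_1_even_poly[OF p(1)] by (simp add: split_def)
  from small_add[OF fp this] show ?thesis by simp
qed

text \<open>In the telescoped difference each error of index \<open>n\<close> is multiplied by a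
  factor of index 1. This gain of one order drives the inversion of the cosine.\<close>

lemma expands_mult_gain:
  assumes "expands n f" "expands n g" "small 1 f" "small 1 g" "n \<ge> 1"
  shows "expands (Suc n) (\<lambda>x. f x * g x)"
proof -
  obtain p q where p: "even_poly p" "small n (\<lambda>x. f x - p x)" and q: "even_poly q" "small n (\<lambda>x. g x - q x)"
    using assms by (auto simp: expands_def)
  have "small 1 q"
    using small_diff[OF assms(4) small_mono[OF q(2) assms(5)]] by simp
  then have "small (1 + n) (\<lambda>x. f x * (g x - q x) + q x * (f x - p x))"
    using assms(3) p q by (intro small_add small_mult)
  then show ?thesis
    unfolding expands_def using even_poly_mult[OF p(1) q(1)]
    by (intro exI[of _ "\<lambda>x. p x * q x"]) (auto simp: algebra_simps)
qed

text \<open>Substitution into a Taylor polynomial. The estimate on \<open>h\<close> is required only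
  along the values of \<open>f\<close>, which admits one-sided functions such as
  \<open>cos (sqrt x)\<close> for nonnegative \<open>x\<close>.\<close>

lemma expands_compose:
  assumes "expands n f" "small 1 f"
    and "\<And>\<Lambda>. eventually (\<lambda>x. \<bar>h (f x) - (\<Sum>j<n. a j * f x ^ j)\<bar> \<le> C * \<bar>f x ^ n\<bar>) (origin_filter \<Lambda>)"
  shows "expands n (\<lambda>x. h (f x))"
proof -
  have "small n (\<lambda>x. h (f x) - (\<Sum>j<n. a j * f x ^ j))"
    using small_bound[OF small_power[OF assms(2), of n] assms(3)] by simp
  from expands_add[OF expands_small[OF this], of "\<lambda>x. \<Sum>j<n. a j * f x ^ j"] show ?thesis
    using assms(1) by (simp add: expands_sum expands_mult expands_const expands_power)
qed

section \<open>Expansions of the cosine, the cardinal sine, reciprocals and the squared arc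
  cosine\<close>

text \<open>The cardinal sine; filling the value at 0 absorbs the case distinctions in
  \<open>Exp_S2\<close> and \<open>Log_S2\<close>.\<close>

definition snc :: "real \<Rightarrow> real" where
  "snc t = (if t = 0 then 1 else sin t / t)"

lemma snc_0 [simp]: "snc 0 = 1"
  by (simp add: snc_def)

lemma snc_minus [simp]: "snc (- t) = snc t"
  by (simp add: snc_def)

lemma snc_abs_mult: "snc (\<bar>l\<bar> * t) = snc (l * t)"
  by (cases "l \<ge> 0") (use snc_minus[of "l * t"] in auto)

lemma cos_abs_mult: "cos (\<bar>l\<bar> * t) = cos (l * t)" for l t :: real
  by (cases "l \<ge> 0") auto

lemma mult_snc: "t * snc t = sin t"
  by (simp add: snc_def)

lemma snc_arccos_nonzero: "-1 < d \<Longrightarrow> d \<le> 1 \<Longrightarrow> snc (arccos d) \<noteq> 0"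
  by (cases "d = 1") (auto simp: snc_def sin_arccos_nonzero)

text \<open>Odd cosine coefficients vanish, so \<open>2 * n\<close> Maclaurin terms in
  \<open>sqrt x\<close> collapse to \<open>n\<close> terms in \<open>x\<close>.\<close>

lemma cos_sqrt_taylor:
  assumes "0 \<le> x"
  shows "\<bar>cos (sqrt x) - (\<Sum>j<n. (-1) ^ j / fact (2 * j) * x ^ j)\<bar> \<le> 1 / fact (2 * n) * \<bar>x ^ n\<bar>"
proof -
  have "(\<Sum>m<2 * n. cos_coeff m * sqrt x ^ m) = (\<Sum>j<n. (-1) ^ j / fact (2 * j) * x ^ j)"
    using assms by (induction n) (auto simp: cos_coeff_def power_mult)
  moreover obtain t where "cos (sqrt x) = (\<Sum>m<2 * n. cos_coeff m * sqrt x ^ m)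
      + cos (t + 1 / 2 * real (2 * n) * pi) / fact (2 * n) * sqrt x ^ (2 * n)"
    using Maclaurin_cos_expansion[of "sqrt x" "2 * n"] by blast
  ultimately have "cos (sqrt x) - (\<Sum>j<n. (-1) ^ j / fact (2 * j) * x ^ j)
      = cos (t + 1 / 2 * real (2 * n) * pi) / fact (2 * n) * x ^ n"
    using assms by (simp add: power_mult)
  then show ?thesis
    by (simp add: abs_mult divide_right_mono mult_left_le_one_le)
qed

lemma snc_sqrt_taylor:
  assumes "0 \<le> x"
  shows "\<bar>snc (sqrt x) - (\<Sum>j<n. (-1) ^ j / fact (2 * j + 1) * x ^ j)\<bar> \<le> 1 * \<bar>x ^ n\<bar>"
proof (cases "x = 0")
  case True
  \<comment> \<open>For \<open>n = 0\<close> the sum is empty and the bound is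
    \<open>0 ^ 0 = 1\<close>; otherwise the term \<open>j = 0\<close> gives exactly 1.\<close>
  then show ?thesis by (cases n) (simp_all add: sum.lessThan_Suc_shift del: sum.lessThan_Suc)
next
  case False
  define t where "t = sqrt x"
  have t: "t > 0" "x = t\<^sup>2" using assms False by (auto simp: t_def)
  \<comment> \<open>The indices up to \<open>2 * n\<close> contain \<open>n\<close> odd ones; the
    common factor \<open>t\<close> is divided out at the end.\<close>
  have "(\<Sum>m<2 * n + 1. sin_coeff m * t ^ m) = t * (\<Sum>j<n. (-1) ^ j / fact (2 * j + 1) * x ^ j)"
  proof (induction n)
    case (Suc n)
    have "sin_coeff (2 * n + 1) * t ^ (2 * n + 1) = t * ((-1) ^ n / fact (2 * n + 1) * x ^ n)"
      by (simp add: sin_coeff_def power_mult t(2) del: fact_Suc)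
    moreover have "sin_coeff (2 * n + 2) = 0"
      by (simp add: sin_coeff_def)
    ultimately show ?case
      using Suc by (simp add: distrib_left del: fact_Suc)
  qed simp
  then have "\<bar>t * (snc t - (\<Sum>j<n. (-1) ^ j / fact (2 * j + 1) * x ^ j))\<bar>
      \<le> inverse (fact (2 * n + 1)) * \<bar>t\<bar> ^ (2 * n + 1)"
    using Maclaurin_sin_bound[of t "2 * n + 1"] by (simp only: right_diff_distrib mult_snc)
  also have "\<dots> \<le> 1 * \<bar>t\<bar> ^ (2 * n + 1)"
    using fact_ge_1[of "2 * n + 1", where 'a = real] by (intro mult_right_mono) (auto simp: field_simps)
  also have "\<dots> = t * x ^ n"
    using t by (simp add: power_mult)
  finally show ?thesis
    using t by (simp add: abs_mult t_def[symmetric])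
qed

lemma expands_cos_sqrt:
  "expands n f \<Longrightarrow> small 1 f \<Longrightarrow> (\<And>x. 0 \<le> f x) \<Longrightarrow> expands n (\<lambda>x. cos (sqrt (f x)))"
  by (erule expands_compose[where C = "1 / fact (2 * n)" and a = "\<lambda>j. (-1) ^ j / fact (2 * j)"])
    (use cos_sqrt_taylor in \<open>auto intro!: always_eventually\<close>)

lemma expands_snc_sqrt:
  "expands n f \<Longrightarrow> small 1 f \<Longrightarrow> (\<And>x. 0 \<le> f x) \<Longrightarrow> expands n (\<lambda>x. snc (sqrt (f x)))"
  by (erule expands_compose[where C = 1 and a = "\<lambda>j. (-1) ^ j / fact (2 * j + 1)"])
    (use snc_sqrt_taylor in \<open>auto intro!: always_eventually\<close>)

text \<open>Geometric series in \<open>1 - f x\<close>; the constant 2 bounds the reciprocal of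
  \<open>f x\<close> once \<open>1 - f x\<close> is below 1/2 in absolute value.\<close>

lemma expands_inverse:
  assumes "expands n f" "n \<ge> 1" "\<And>l. f (0, 0, l) = 1"
  shows "expands n (\<lambda>x. 1 / f x)"
proof -
  let ?g = "\<lambda>x. 1 - f x"
  have g: "expands n ?g" by (intro expands_diff expands_const assms)
  have small: "small 1 ?g" by (rule expands_vanishing_imp_small_1[OF g]) (use assms in auto)
  have "eventually (\<lambda>x. \<bar>1 / (1 - ?g x) - (\<Sum>j<n. 1 * ?g x ^ j)\<bar> \<le> 2 * \<bar>?g x ^ n\<bar>) (origin_filter \<Lambda>)" for \<Lambda>
  proof -
    have "eventually (\<lambda>x. \<bar>?g x\<bar> < 1 / 2) (origin_filter \<Lambda>)"
      using tendstoD[OF small_tendsto[OF small], of "1 / 2"] by (simp add: dist_real_def)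
    then show ?thesis
    proof eventually_elim
      case (elim x)
      define t where "t = ?g x"
      have t: "\<bar>t\<bar> < 1 / 2" using elim by (simp add: t_def)
      then have "1 / (1 - t) - (\<Sum>j<n. t ^ j) = t ^ n / (1 - t)"
        by (simp add: sum_gp_strict diff_divide_distrib)
      also have "\<bar>t ^ n / (1 - t)\<bar> = \<bar>t ^ n\<bar> * (1 / (1 - t))"
        using t by (simp add: abs_divide)
      also have "\<dots> \<le> \<bar>t ^ n\<bar> * 2"
        using t by (intro mult_left_mono) (auto simp: field_simps)
      finally show ?case unfolding t_def[symmetric] by simp
    qed
  qed
  from expands_compose[OF g small this] show ?thesis by simp
qed

lemma expands_mono: "expands n f \<Longrightarrow> m \<le> n \<Longrightarrow> expands m f"
  unfolding expands_def using small_mono by blast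

text \<open>With \<open>t = arccos d\<close> at most 2,
  \<open>cos t \<le> 1 - t\<^sup>2 / 2 + t\<^sup>4 / 24\<close> and
  \<open>t\<^sup>4 \<le> 4 * t\<^sup>2\<close> give
  \<open>d \<le> 1 - t\<^sup>2 / 3\<close>.\<close>

lemma arccos_sq_le:
  assumes "0 \<le> d" "d \<le> 1" shows "(arccos d)\<^sup>2 \<le> 3 * (1 - d)"
proof -
  define t where "t = arccos d"
  have "0 \<le> t" "t \<le> 2"
    using arccos_lbound[of d] arccos_le_pi2[of d] pi_half_less_two assms by (auto simp: t_def)
  then have t4: "t\<^sup>2 * t\<^sup>2 \<le> 4 * t\<^sup>2"
    using power_mono[of t 2 2] by (intro mult_right_mono) auto
  have "\<bar>cos (sqrt (t\<^sup>2)) - (1 - t\<^sup>2 / 2)\<bar> \<le> t\<^sup>2 * t\<^sup>2 / 24"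
    using cos_sqrt_taylor[of "t\<^sup>2" 2] by (simp add: eval_nat_numeral)
  moreover have "cos (sqrt (t\<^sup>2)) = d"
    using \<open>0 \<le> t\<close> assms by (simp add: t_def)
  ultimately have "\<bar>d - (1 - t\<^sup>2 / 2)\<bar> \<le> t\<^sup>2 * t\<^sup>2 / 24"
    by metis
  then have "d - (1 - t\<^sup>2 / 2) \<le> 4 * t\<^sup>2 / 24"
    using t4 by linarith
  then have "t\<^sup>2 \<le> 3 * (1 - d)"
    by argo
  then show ?thesis by (simp add: t_def)
qed

text \<open>\<open>arccos d\<close> behaves like a square root of \<open>1 - d\<close> near
  \<open>d = 1\<close>, but its square is smooth there. The bound on \<open>d\<close> ensures that
  the cosine of \<open>arccos d\<close> is \<open>d\<close>.\<close>

lemma expands_arccos_sq: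
  assumes d: "expands n d" "n \<ge> 1" "\<And>l. d (0, 0, l) = 1"
    and le1: "\<And>\<Lambda>. eventually (\<lambda>x. \<bar>d x\<bar> \<le> 1) (origin_filter \<Lambda>)"
  shows "expands n (\<lambda>x. (arccos (d x))\<^sup>2)" and "small 1 (\<lambda>x. (arccos (d x))\<^sup>2)"
proof -
  let ?X = "\<lambda>x. (arccos (d x))\<^sup>2"
  let ?c = "\<lambda>j. (-1) ^ j / fact (2 * j) :: real"
  \<comment> \<open>The cosine polynomial in \<open>?X\<close> without its first two terms
    \<open>1 - ?X / 2\<close> and divided by the square of \<open>?X\<close>; thus
    \<open>n + 2\<close> terms are split off in \<open>?r\<close>.\<close>
  let ?q = "\<lambda>x. \<Sum>j<n. ?c (j + 2) * ?X x ^ j"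
  let ?r = "\<lambda>x. d x - (\<Sum>j<n + 2. ?c j * ?X x ^ j)"
  have ed: "expands n (\<lambda>x. 1 - d x)" by (intro expands_diff expands_const d)
  have sd: "small 1 (\<lambda>x. 1 - d x)" by (rule expands_vanishing_imp_small_1[OF ed]) (use d in auto)
  show X: "small 1 ?X"
  proof (rule small_bound[OF sd])
    fix \<Lambda>
    have "eventually (\<lambda>x. \<bar>1 - d x\<bar> < 1) (origin_filter \<Lambda>)"
      using tendstoD[OF small_tendsto[OF sd], of 1] by (simp add: dist_real_def)
    with le1 show "eventually (\<lambda>x. \<bar>?X x\<bar> \<le> 3 * \<bar>1 - d x\<bar>) (origin_filter \<Lambda>)"
    proof eventually_elim
      case (elim x)
      then show ?case using arccos_sq_le[of "d x"] by simp
    qed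
  qed
  have r: "small n ?r"
  proof -
    have "small (n + 2) ?r"
    proof (rule small_bound)
      show "small (n + 2) (\<lambda>x. ?X x ^ (n + 2))" using small_power[OF X, of "n + 2"] by simp
      show "eventually (\<lambda>x. \<bar>?r x\<bar> \<le> 1 / fact (2 * (n + 2)) * \<bar>?X x ^ (n + 2)\<bar>) (origin_filter \<Lambda>)" for \<Lambda>
        using le1
      proof eventually_elim
        case (elim x)
        then have "cos (sqrt (?X x)) = d x" using arccos_lbound[of "d x"] by simp
        then show ?case using cos_sqrt_taylor[of "?X x" "n + 2"] by (simp del: sum.lessThan_Suc)
      qed
    qed
    then show ?thesis by (rule small_mono) simp
  qed
  \<comment> \<open>\<open>cos\<close> is inverted by a fixed-point iteration: in this equation an expansion of \<open>?X\<close>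
    to order \<open>m\<close> determines the right-hand side to order \<open>m + 1\<close>.\<close>
  have fixpoint: "?X x = 2 * (1 - d x) + 2 * (?X x * (?X x * ?q x)) + 2 * ?r x" for x
    by (simp add: sum.lessThan_Suc_shift sum_distrib_left power2_eq_square algebra_simps
        del: sum.lessThan_Suc)
  have "expands m ?X" if "1 \<le> m" "m \<le> n" for m
    using that
  proof (induction m rule: dec_induct)
    case base
    then show ?case using X by (intro expands_small)
  next
    case (step m)
    then have IH: "expands m ?X" by simp
    have q: "expands m ?q" by (intro expands_sum expands_mult expands_const expands_power IH)
    have "small 1 (\<lambda>x. ?X x * ?q x)"
      using small_mult[OF X expands_imp_small_0[OF q]] by simp
    then have "expands (Suc m) (\<lambda>x. ?X x * (?X x * ?q x))"
      using step by (intro expands_mult_gain expands_mult IH q X) auto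
    moreover have "expands (Suc m) (\<lambda>x. 1 - d x)" "expands (Suc m) ?r"
      using step expands_mono[OF ed] expands_mono[OF expands_small[OF r]] by auto
    ultimately have "expands (Suc m)
        (\<lambda>x. 2 * (1 - d x) + 2 * (?X x * (?X x * ?q x)) + 2 * ?r x)"
      by (intro expands_add expands_mult[OF expands_const])
    then show ?case by (simp only: fixpoint[symmetric])
  qed
  then show "expands n ?X" using d(2) by blast
qed

section \<open>Spherical trigonometry of the interpolation\<close>

text \<open>The spherical law of cosines: for tangent \<open>U\<close>, \<open>W\<close> this is the
  inner product of \<open>Exp_S2 y U\<close> and \<open>Exp_S2 y W\<close>.\<close>

definition arc_cos :: "real^3 \<Rightarrow> real^3 \<Rightarrow> real" where
  "arc_cos U W = cos (norm U) * cos (norm W) + snc (norm U) * snc (norm W) * (U \<bullet> W)"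

text \<open>With \<alpha> = \<open>arccos d\<close> in (0, pi) this is
  \<open>sin (l * \<alpha>) / sin \<alpha>\<close>, rewritten so that \<open>d = 1\<close> yields
  \<open>l\<close>.\<close>

definition slerp_snd :: "real \<Rightarrow> real \<Rightarrow> real" where
  "slerp_snd d l = l * snc (l * arccos d) / snc (arccos d)"

text \<open>The subtraction formula applied to
  \<open>sin ((1 - l) * \<alpha>) / sin \<alpha>\<close>.\<close>

definition slerp_fst :: "real \<Rightarrow> real \<Rightarrow> real" where
  "slerp_fst d l = cos (l * arccos d) - d * slerp_snd d l"

text \<open>The inner product of \<open>y\<close> with the interpolated point.\<close>

definition end_cos :: "real^3 \<Rightarrow> real^3 \<Rightarrow> real \<Rightarrow> real" where
  "end_cos U W l = slerp_fst (arc_cos U W) l * cos (norm U) + slerp_snd (arc_cos U W) l * cos (norm W)"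

text \<open>Splitting along \<open>a\<close> and its orthogonal complement turns the squared norm
  into \<open>cos\<^sup>2 + sin\<^sup>2\<close> of \<open>l * arccos d\<close>. The generality
  serves both the sphere in three-space and the lifted sphere below.\<close>

lemma norm_slerp:
  fixes a b :: "'a::real_inner"
  assumes "norm a = 1" "norm b = 1" "-1 < a \<bullet> b"
  shows "norm (slerp_fst (a \<bullet> b) l *\<^sub>R a + slerp_snd (a \<bullet> b) l *\<^sub>R b) = 1"
proof -
  define d t A B where "d = a \<bullet> b" and "t = arccos d" and "A = slerp_fst d l" and "B = slerp_snd d l"
  have d: "-1 < d" "d \<le> 1"
    using assms norm_cauchy_schwarz[of a b] by (simp_all add: d_def)
  then have "snc t \<noteq> 0" "sin t ^ 2 = 1 - d\<^sup>2"
    using snc_arccos_nonzero sin_squared_eq[of t] by (simp_all add: t_def)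
  have "B * (t * snc t) = l * t * snc (l * t)"
    using \<open>snc t \<noteq> 0\<close> by (simp add: B_def slerp_snd_def t_def[symmetric])
  then have "B * sin t = sin (l * t)"
    by (simp only: mult_snc)
  then have "B\<^sup>2 * (1 - d\<^sup>2) = (sin (l * t))\<^sup>2"
    using \<open>sin t ^ 2 = 1 - d\<^sup>2\<close> by (metis power_mult_distrib)
  moreover have "A + d * B = cos (l * t)"
    by (simp add: A_def B_def slerp_fst_def t_def)
  ultimately have "(A + d * B)\<^sup>2 + B\<^sup>2 * (1 - d\<^sup>2) = 1"
    by simp
  moreover have "a \<bullet> a = 1" "b \<bullet> b = 1" using assms by (simp_all add: norm_eq_1)
  ultimately have "(A *\<^sub>R a + B *\<^sub>R b) \<bullet> (A *\<^sub>R a + B *\<^sub>R b) = 1"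
    by (simp add: inner_add d_def[symmetric] inner_commute[of b a] power2_eq_square algebra_simps)
  then show ?thesis by (simp add: norm_eq_1 A_def B_def d_def)
qed

text \<open>\<open>sphere_lift\<close> is the exponential map at \<open>(1, 0)\<close> of the unit sphere of \<open>\<real> \<times> \<real>\<^sup>3\<close>.
  It yields the bounds on \<open>arc_cos\<close> and \<open>end_cos\<close> for all \<open>U, W \<in> \<real>\<^sup>3\<close>, which
  need not be tangent to \<open>S\<^sup>2\<close> at a common point.\<close>

definition sphere_lift :: "real^3 \<Rightarrow> real \<times> (real^3)" where
  "sphere_lift U = (cos (norm U), snc (norm U) *\<^sub>R U)"

lemma norm_sphere_lift: "norm (sphere_lift U) = 1"
proof -
  have "(snc (norm U) * norm U)\<^sup>2 = (sin (norm U))\<^sup>2"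
    by (metis mult_snc mult.commute)
  then show ?thesis
    by (simp add: sphere_lift_def norm_Pair power_mult_distrib)
qed

lemma sphere_lift_inner: "sphere_lift U \<bullet> sphere_lift W = arc_cos U W"
  by (simp add: sphere_lift_def arc_cos_def)

lemma abs_arc_cos_le: "\<bar>arc_cos U W\<bar> \<le> 1"
  using Cauchy_Schwarz_ineq2[of "sphere_lift U" "sphere_lift W"]
  by (simp add: sphere_lift_inner norm_sphere_lift)

text \<open>\<open>end_cos\<close> is the first coordinate of an interpolated unit vector on the
  lifted sphere.\<close>

lemma abs_end_cos_le:
  assumes "-1 < arc_cos U W" shows "\<bar>end_cos U W l\<bar> \<le> 1"
proof -
  let ?v = "slerp_fst (arc_cos U W) l *\<^sub>R sphere_lift U + slerp_snd (arc_cos U W) l *\<^sub>R sphere_lift W"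
  have "norm ?v = 1"
    using norm_slerp[of "sphere_lift U" "sphere_lift W" l] assms
    by (simp add: sphere_lift_inner norm_sphere_lift)
  moreover have "fst ?v = end_cos U W l"
    by (simp add: sphere_lift_def end_cos_def)
  ultimately show ?thesis
    by (metis norm_fst_le prod.collapse real_norm_def)
qed

section \<open>Closed formula for \<open>G_S2\<close>\<close>

lemma Exp_S2_eq: "Exp_S2 y v = cos (norm v) *\<^sub>R y + snc (norm v) *\<^sub>R v"
  by (simp add: Exp_S2_def snc_def)

lemma norm_Exp_S2:
  assumes "y \<in> S2" "v \<in> tangent_S2 y" shows "norm (Exp_S2 y v) = 1"
proof -
  have "y \<bullet> y = 1" "v \<bullet> y = 0" "y \<bullet> v = 0"
    using assms by (auto simp: tangent_S2_def norm_eq_1 inner_commute)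
  moreover have "v \<bullet> v = norm v * norm v"
    by (simp add: dot_square_norm power2_eq_square)
  ultimately have "Exp_S2 y v \<bullet> Exp_S2 y v = (cos (norm v))\<^sup>2 + (norm v * snc (norm v))\<^sup>2"
    by (simp add: Exp_S2_eq inner_add power2_eq_square)
  then show ?thesis by (simp add: norm_eq_1 mult_snc)
qed

text \<open>Unit vectors with inner product 1 coincide, so the angle is 0 only in the case
  \<open>z = y\<close>. At the antipode both sides are 0 through division by zero.\<close>

lemma Log_S2_eq:
  assumes "norm y = 1" "norm z = 1"
  shows "Log_S2 y z = (1 / snc (arccos (y \<bullet> z))) *\<^sub>R (z - (y \<bullet> z) *\<^sub>R y)"
proof (cases "z = y")
  case True
  then show ?thesis using assms by (simp add: Log_S2_def norm_eq_1)
next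
  case False
  have "y \<bullet> z \<noteq> 1"
  proof
    assume "y \<bullet> z = 1"
    then have "norm (z - y) ^ 2 = 0"
      using assms by (simp add: power2_norm_eq_inner inner_diff norm_eq_1 inner_commute)
    then show False using False by simp
  qed
  moreover have "\<bar>y \<bullet> z\<bar> \<le> 1" using Cauchy_Schwarz_ineq2[of y z] assms by simp
  ultimately have "arccos (y \<bullet> z) \<noteq> 0"
    by (metis abs_le_iff cos_arccos cos_zero minus_le_iff)
  then show ?thesis using False by (simp add: Log_S2_def snc_def)
qed

text \<open>The tangential part of \<open>z\<close> has length \<open>sin t = t * snc t\<close>, and
  the logarithm divides it by \<open>snc t\<close>, which is nonzero away from the antipode.\<close>

lemma norm_Log_S2:
  assumes "norm y = 1" "norm z = 1" "-1 < y \<bullet> z"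
  shows "norm (Log_S2 y z) = arccos (y \<bullet> z)"
proof -
  define d t where "d = y \<bullet> z" and "t = arccos d"
  have d: "-1 < d" "d \<le> 1"
    using assms norm_cauchy_schwarz[of y z] by (simp_all add: d_def)
  then have t: "snc t \<noteq> 0" "0 \<le> t" "cos t = d"
    using snc_arccos_nonzero arccos_lbound by (simp_all add: t_def)
  have "z \<bullet> y = d" "y \<bullet> z = d"
    by (simp_all add: d_def inner_commute)
  then have "(norm (z - d *\<^sub>R y))\<^sup>2 = 1 - d\<^sup>2"
    using assms unfolding power2_norm_eq_inner
    by (simp add: inner_diff norm_eq_1 power2_eq_square)
  also have "\<dots> = (t * snc t)\<^sup>2"
    using sin_squared_eq[of t] t by (simp add: mult_snc)
  finally have "norm (z - d *\<^sub>R y) = \<bar>t * snc t\<bar>"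
    by (metis real_sqrt_abs abs_norm_cancel)
  then show ?thesis
    using t Log_S2_eq[OF assms(1,2)] by (simp add: d_def[symmetric] t_def[symmetric] abs_mult)
qed

text \<open>The scaled logarithm has length \<open>\<bar>l\<bar> * arccos (a \<bullet> b)\<close>;
  the absolute value disappears because \<open>cos\<close> and \<open>snc\<close> are even.\<close>

lemma SLERP_eq:
  assumes "norm a = 1" "norm b = 1" "-1 < a \<bullet> b"
  shows "SLERP a b l = slerp_fst (a \<bullet> b) l *\<^sub>R a + slerp_snd (a \<bullet> b) l *\<^sub>R b"
proof -
  have "norm (l *\<^sub>R Log_S2 a b) = \<bar>l\<bar> * arccos (a \<bullet> b)"
    using norm_Log_S2[OF assms] by simp
  then have "SLERP a b l = cos (l * arccos (a \<bullet> b)) *\<^sub>R a +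
      snc (l * arccos (a \<bullet> b)) *\<^sub>R (l *\<^sub>R Log_S2 a b)"
    by (simp only: SLERP_def Exp_S2_eq snc_abs_mult cos_abs_mult)
  then show ?thesis
    by (simp add: Log_S2_eq[OF assms(1,2)] slerp_fst_def slerp_snd_def algebra_simps)
qed

text \<open>The logarithm subtracts the component along \<open>y\<close>, so only multiples of
  \<open>U\<close> and \<open>W\<close> survive. The two strict bounds exclude the antipodal
  cases.\<close>

lemma G_S2_eq:
  assumes y: "y \<in> S2" "U \<in> tangent_S2 y" "W \<in> tangent_S2 y"
    and gt: "-1 < arc_cos U W" "-1 < end_cos U W l"
  shows "G_S2_defined y U W l"
    and "G_S2 y U W l =
      (slerp_fst (arc_cos U W) l * snc (norm U) / snc (arccos (end_cos U W l))) *\<^sub>R U +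
      (slerp_snd (arc_cos U W) l * snc (norm W) / snc (arccos (end_cos U W l))) *\<^sub>R W"
proof -
  let ?a = "Exp_S2 y U" and ?b = "Exp_S2 y W"
  have inner: "y \<bullet> y = 1" "U \<bullet> y = 0" "y \<bullet> U = 0" "W \<bullet> y = 0" "y \<bullet> W = 0"
    using y by (auto simp: tangent_S2_def norm_eq_1 inner_commute)
  have ab: "norm ?a = 1" "norm ?b = 1" "?a \<bullet> ?b = arc_cos U W"
    using norm_Exp_S2 y by (auto simp: Exp_S2_eq inner_add inner arc_cos_def)
  let ?P = "SLERP ?a ?b l"
  have P: "?P = slerp_fst (arc_cos U W) l *\<^sub>R ?a + slerp_snd (arc_cos U W) l *\<^sub>R ?b"
    using SLERP_eq ab gt by simp
  have "norm ?P = 1"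
    using norm_slerp[OF ab(1,2), of l] ab(3) gt P by simp
  have e: "y \<bullet> ?P = end_cos U W l"
    unfolding P by (simp add: Exp_S2_eq inner_add inner end_cos_def)
  have "?b \<noteq> - ?a"
    using ab gt by (metis inner_minus_right less_irrefl norm_eq_1)
  moreover have "?P \<noteq> - y"
    using e gt inner by (metis inner_minus_right less_irrefl)
  ultimately show "G_S2_defined y U W l"
    by (simp add: G_S2_defined_def)
  have "?P - end_cos U W l *\<^sub>R y = (slerp_fst (arc_cos U W) l * snc (norm U)) *\<^sub>R U +
      (slerp_snd (arc_cos U W) l * snc (norm W)) *\<^sub>R W"
    unfolding P by (simp add: Exp_S2_eq end_cos_def algebra_simps)
  then show "G_S2 y U W l =
      (slerp_fst (arc_cos U W) l * snc (norm U) / snc (arccos (end_cos U W l))) *\<^sub>R U +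
      (slerp_snd (arc_cos U W) l * snc (norm W) / snc (arccos (end_cos U W l))) *\<^sub>R W"
    using Log_S2_eq[of y ?P] y(1) \<open>norm ?P = 1\<close>
    by (simp add: G_S2_def e scaleR_add_right)
qed

section \<open>Expansions of the two coefficients\<close>

lemma arc_cos_0 [simp]: "arc_cos 0 0 = 1" by (simp add: arc_cos_def)
lemma slerp_snd_1 [simp]: "slerp_snd 1 l = l" by (simp add: slerp_snd_def)
lemma slerp_fst_1 [simp]: "slerp_fst 1 l = 1 - l" by (simp add: slerp_fst_def)
lemma end_cos_0 [simp]: "end_cos 0 0 l = 1" by (simp add: end_cos_def)

lemma expands_norms:
  assumes "n \<ge> 1"
  shows "expands n (\<lambda>(U, W, l). cos (norm U))" "expands n (\<lambda>(U, W, l). cos (norm W))"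
    "expands n (\<lambda>(U, W, l). snc (norm U))" "expands n (\<lambda>(U, W, l). snc (norm W))"
proof -
  have "small 1 (\<lambda>(U, W, l). U \<bullet> U)" "small 1 (\<lambda>(U, W, l). W \<bullet> W)"
    by (intro small_homog_poly homog_poly_inner)+
  from expands_cos_sqrt[OF expands_inner(1) this(1)] expands_cos_sqrt[OF expands_inner(2) this(2)]
    expands_snc_sqrt[OF expands_inner(1) this(1)] expands_snc_sqrt[OF expands_inner(2) this(2)]
  show "expands n (\<lambda>(U, W, l). cos (norm U))" "expands n (\<lambda>(U, W, l). cos (norm W))"
    "expands n (\<lambda>(U, W, l). snc (norm U))" "expands n (\<lambda>(U, W, l). snc (norm W))"
    by (simp_all add: split_def norm_eq_sqrt_inner)
qed

lemma eventually_gt_minus_1: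
  assumes "expands n f" "n \<ge> 1" "\<And>l. f (0, 0, l) = 1"
  shows "eventually (\<lambda>x. -1 < f x) (origin_filter \<Lambda>)"
proof -
  have "small 1 (\<lambda>x. f x - 1)"
    by (rule expands_vanishing_imp_small_1[OF expands_diff[OF assms(1) expands_const]]) (use assms in auto)
  from tendstoD[OF small_tendsto[OF this, of \<Lambda>], of 2] show ?thesis
    by (auto simp: dist_real_def elim: eventually_mono)
qed

lemma expands_arc_cos:
  assumes "n \<ge> 1" shows "expands n (\<lambda>(U, W, l). arc_cos U W)"
proof -
  have "expands n (\<lambda>x. (\<lambda>(U, W, l). cos (norm U)) x * (\<lambda>(U, W, l). cos (norm W)) x +
      (\<lambda>(U, W, l). snc (norm U)) x * (\<lambda>(U, W, l). snc (norm W)) x * (\<lambda>(U, W, l). U \<bullet> W) x)"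
    by (intro expands_add expands_mult expands_norms expands_inner assms)
  then show ?thesis by (simp add: arc_cos_def split_def)
qed

lemma expands_slerp:
  assumes n: "n \<ge> 1"
  shows "expands n (\<lambda>(U, W, l). slerp_snd (arc_cos U W) l)"
    and "expands n (\<lambda>(U, W, l). slerp_fst (arc_cos U W) l)"
proof -
  let ?d = "\<lambda>(U, W, l :: real). arc_cos U W"
  let ?l = "\<lambda>(U :: real^3, W :: real^3, l :: real). l"
  \<comment> \<open>The angle enters only through even functions of \<alpha> and
    \<open>l * \<alpha>\<close>; \<open>?X\<close> and \<open>?Y\<close> are the squares of these
    two.\<close>
  let ?X = "\<lambda>x. (arccos (?d x))\<^sup>2"
  let ?Y = "\<lambda>x. ?l x ^ 2 * ?X x"
  have d: "expands n ?d" by (rule expands_arc_cos[OF n])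
  have X: "expands n ?X" "small 1 ?X"
    by (rule expands_arccos_sq[OF d n]; simp add: abs_arc_cos_le split_def)+
  have Y: "expands n ?Y"
    by (intro expands_mult expands_power expands_parameter X)
  have Y': "small 1 ?Y"
    using small_mult[OF expands_imp_small_0[OF expands_power[OF expands_parameter, of n 2]] X(2)] by simp
  have sqX: "sqrt (?X x) = arccos (?d x)" for x
    using abs_arc_cos_le[of "fst x" "fst (snd x)"] arccos_lbound[of "?d x"]
    by (simp add: split_def abs_le_iff)
  have sqY: "sqrt (?Y x) = \<bar>?l x\<bar> * arccos (?d x)" for x
    using sqX[of x] by (simp add: real_sqrt_mult)
  have "expands n (\<lambda>x. ?l x * snc (sqrt (?Y x)) * (1 / snc (sqrt (?X x))))"
    by (intro expands_mult expands_parameter expands_snc_sqrt X Y Y' expands_inverse n) simp_all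
  then show B: "expands n (\<lambda>(U, W, l). slerp_snd (arc_cos U W) l)"
    unfolding sqX sqY by (simp add: slerp_snd_def snc_abs_mult split_def)
  have "expands n (\<lambda>x. cos (sqrt (?Y x)) - ?d x * (\<lambda>(U, W, l). slerp_snd (arc_cos U W) l) x)"
    by (intro expands_diff expands_mult expands_cos_sqrt Y Y' d B) simp
  then show "expands n (\<lambda>(U, W, l). slerp_fst (arc_cos U W) l)"
    unfolding sqY by (simp add: slerp_fst_def cos_abs_mult split_def)
qed

lemma expands_end_cos:
  assumes n: "n \<ge> 1" shows "expands n (\<lambda>(U, W, l). end_cos U W l)"
proof -
  have "expands n (\<lambda>x. (\<lambda>(U, W, l). slerp_fst (arc_cos U W) l) x * (\<lambda>(U, W, l). cos (norm U)) x +
      (\<lambda>(U, W, l). slerp_snd (arc_cos U W) l) x * (\<lambda>(U, W, l). cos (norm W)) x)"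
    by (intro expands_add expands_mult expands_slerp expands_norms n)
  then show ?thesis by (simp add: end_cos_def split_def)
qed

lemma expands_coefficients:
  assumes n: "n \<ge> 1"
  shows "expands n (\<lambda>(U, W, l).
      slerp_fst (arc_cos U W) l * snc (norm U) / snc (arccos (end_cos U W l)))"
    and "expands n (\<lambda>(U, W, l).
      slerp_snd (arc_cos U W) l * snc (norm W) / snc (arccos (end_cos U W l)))"
proof -
  let ?e = "\<lambda>(U, W, l). end_cos U W l"
  let ?X = "\<lambda>x. (arccos (?e x))\<^sup>2"
  have "eventually (\<lambda>x. \<bar>?e x\<bar> \<le> 1) (origin_filter \<Lambda>)" for \<Lambda>
    using eventually_gt_minus_1[OF expands_arc_cos[OF n] n]
    by (rule eventually_mono[of _ _ ]) (auto simp: abs_end_cos_le)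
  then have X: "expands n ?X" "small 1 ?X"
    by (intro expands_arccos_sq[OF expands_end_cos[OF n] n]; simp)+
  have inv: "expands n (\<lambda>x. 1 / snc (sqrt (?X x)))"
    by (intro expands_inverse expands_snc_sqrt X n) simp_all
  have snc_sqrt: "snc (sqrt (t\<^sup>2)) = snc t" for t
    by (simp add: abs_if)
  have "expands n (\<lambda>x. (\<lambda>(U, W, l). slerp_fst (arc_cos U W) l) x * (\<lambda>(U, W, l). snc (norm U)) x *
      (1 / snc (sqrt (?X x))))"
    "expands n (\<lambda>x. (\<lambda>(U, W, l). slerp_snd (arc_cos U W) l) x * (\<lambda>(U, W, l). snc (norm W)) x *
      (1 / snc (sqrt (?X x))))"
    by (intro expands_mult expands_slerp expands_norms inv n)+
  then show "expands n (\<lambda>(U, W, l).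
      slerp_fst (arc_cos U W) l * snc (norm U) / snc (arccos (end_cos U W l)))"
    "expands n (\<lambda>(U, W, l).
      slerp_snd (arc_cos U W) l * snc (norm W) / snc (arccos (end_cos U W l)))"
    unfolding snc_sqrt by (simp_all add: split_def)
qed

section \<open>The graded expansion of \<open>G_S2\<close>\<close>

lemma expands_graded:
  assumes "expands n f"
  obtains g where "\<And>k. homog_poly k (g k)" "small n (\<lambda>x. f x - (\<Sum>k<n. g k x))"
proof -
  obtain p where p: "even_poly p" "small n (\<lambda>x. f x - p x)"
    using assms by (auto simp: expands_def)
  obtain g where "\<forall>k. homog_poly k (g k)" "small n (\<lambda>x. p x - (\<Sum>k<n. g k x))"
    using even_poly_graded[OF p(1)] by blast
  with small_add[OF p(2) this(2)] that[of g] show ?thesis by (simp add: algebra_simps)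
qed

lemma smallD:
  assumes "small n f"
  obtains \<rho> C where "\<rho> > 0" "C > 0"
    "\<And>U W l. \<bar>l\<bar> \<le> \<Lambda> \<Longrightarrow> norm U + norm W \<le> \<rho> \<Longrightarrow> \<bar>f (U, W, l)\<bar> \<le> C * (norm U + norm W) ^ (2 * n)"
proof -
  have "f \<in> O[origin_filter \<Lambda>](\<lambda>x. pair_size x ^ (2 * n))"
    using assms by (simp add: small_def)
  then obtain C where "C > 0"
    "eventually (\<lambda>x. norm (f x) \<le> C * norm (pair_size x ^ (2 * n))) (origin_filter \<Lambda>)"
    by (elim landau_o.bigE)
  then show ?thesis
    using that by (auto simp: eventually_origin_filter pair_size_def)
qed

text \<open>At the origin the remainder and all pieces of positive degree vanish.\<close>

lemma graded_constant_term:
  assumes "\<And>k. homog_poly k (g k)" "small n (\<lambda>x. f x - (\<Sum>k<n. g k x))" "n \<ge> 1"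
  shows "g 0 (U, W, l) = f (0, 0, l)"
proof -
  obtain \<rho> C where "\<rho> > 0" and bound: "\<And>U W k. \<bar>k\<bar> \<le> \<bar>l\<bar> \<Longrightarrow> norm U + norm W \<le> \<rho> \<Longrightarrow>
      \<bar>f (U, W, k) - (\<Sum>j<n. g j (U, W, k))\<bar> \<le> C * (norm U + norm W) ^ (2 * n)"
    by (rule smallD[OF assms(2), of "\<bar>l\<bar>"]) (rule that)
  from bound[of l 0 0] \<open>\<rho> > 0\<close> assms(3) have "f (0, 0, l) = (\<Sum>j<n. g j (0, 0, l))"
    by (simp add: power_0_left)
  also have "\<dots> = (\<Sum>j<n. if j = 0 then g 0 (0, 0, l) else 0)"
    using homog_poly_vanishes[OF assms(1)] by (intro sum.cong) auto
  finally show ?thesis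
    using assms(3) homog_poly_0[OF assms(1), of "(U, W, l)"] by simp
qed

text \<open>Multiplying scalar errors of order \<open>2 * n\<close> by \<open>U\<close> or
  \<open>W\<close> raises the order to \<open>2 * n + 1\<close>. The polynomials are fixed before
  the \<lambda>-range; only the radius and the constant depend on it.\<close>

lemma G_S2_expansion:
  assumes n: "n \<ge> 1"
  obtains g h where "\<And>k. homog_poly k (g k)" "\<And>k. homog_poly k (h k)"
    "\<And>U W l. g 0 (U, W, l) = 1 - l" "\<And>U W l. h 0 (U, W, l) = l"
    "\<And>\<Lambda>. \<exists>\<rho>>0. \<exists>C>0. \<forall>y\<in>S2. \<forall>U\<in>tangent_S2 y. \<forall>W\<in>tangent_S2 y. \<forall>l.
      \<bar>l\<bar> \<le> \<Lambda> \<longrightarrow> norm U + norm W \<le> \<rho> \<longrightarrow> G_S2_defined y U W l \<and>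
      norm (G_S2 y U W l - (\<Sum>k<n. g k (U, W, l) *\<^sub>R U + h k (U, W, l) *\<^sub>R W))
        \<le> C * (norm U + norm W) ^ (2 * n + 1)"
proof -
  let ?a = "\<lambda>(U, W, l). slerp_fst (arc_cos U W) l * snc (norm U) / snc (arccos (end_cos U W l))"
  let ?b = "\<lambda>(U, W, l). slerp_snd (arc_cos U W) l * snc (norm W) / snc (arccos (end_cos U W l))"
  obtain g where g: "\<And>k. homog_poly k (g k)" "small n (\<lambda>x. ?a x - (\<Sum>k<n. g k x))"
    using expands_graded[OF expands_coefficients(1)[OF n]] by blast
  obtain h where h: "\<And>k. homog_poly k (h k)" "small n (\<lambda>x. ?b x - (\<Sum>k<n. h k x))"
    using expands_graded[OF expands_coefficients(2)[OF n]] by blast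
  have "\<exists>\<rho>>0. \<exists>C>0. \<forall>y\<in>S2. \<forall>U\<in>tangent_S2 y. \<forall>W\<in>tangent_S2 y. \<forall>l.
      \<bar>l\<bar> \<le> \<Lambda> \<longrightarrow> norm U + norm W \<le> \<rho> \<longrightarrow> G_S2_defined y U W l \<and>
      norm (G_S2 y U W l - (\<Sum>k<n. g k (U, W, l) *\<^sub>R U + h k (U, W, l) *\<^sub>R W))
        \<le> C * (norm U + norm W) ^ (2 * n + 1)" for \<Lambda>
  proof -
    have "eventually (\<lambda>x. -1 < (\<lambda>(U, W, l). arc_cos U W) x \<and> -1 < (\<lambda>(U, W, l). end_cos U W l) x)
        (origin_filter \<Lambda>)"
      by (intro eventually_conj eventually_gt_minus_1[OF expands_arc_cos[OF n] n]
          eventually_gt_minus_1[OF expands_end_cos[OF n] n]) auto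
    then obtain \<rho>1 where \<rho>1: "\<rho>1 > 0" "\<And>U W l. \<bar>l\<bar> \<le> \<Lambda> \<Longrightarrow> norm U + norm W \<le> \<rho>1 \<Longrightarrow>
        -1 < arc_cos U W \<and> -1 < end_cos U W l"
      unfolding eventually_origin_filter by auto
    obtain \<rho>2 C2 where \<rho>2: "\<rho>2 > 0" "C2 > 0"
      "\<And>U W l. \<bar>l\<bar> \<le> \<Lambda> \<Longrightarrow> norm U + norm W \<le> \<rho>2 \<Longrightarrow>
        \<bar>?a (U, W, l) - (\<Sum>k<n. g k (U, W, l))\<bar> \<le> C2 * (norm U + norm W) ^ (2 * n)"
      by (rule smallD[OF g(2), of \<Lambda>]) (rule that)
    obtain \<rho>3 C3 where \<rho>3: "\<rho>3 > 0" "C3 > 0"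
      "\<And>U W l. \<bar>l\<bar> \<le> \<Lambda> \<Longrightarrow> norm U + norm W \<le> \<rho>3 \<Longrightarrow>
        \<bar>?b (U, W, l) - (\<Sum>k<n. h k (U, W, l))\<bar> \<le> C3 * (norm U + norm W) ^ (2 * n)"
      by (rule smallD[OF h(2), of \<Lambda>]) (rule that)
    let ?\<rho> = "min \<rho>1 (min \<rho>2 \<rho>3)"
    have "G_S2_defined y U W l \<and>
        norm (G_S2 y U W l - (\<Sum>k<n. g k (U, W, l) *\<^sub>R U + h k (U, W, l) *\<^sub>R W))
          \<le> (C2 + C3) * (norm U + norm W) ^ (2 * n + 1)"
      if y: "y \<in> S2" "U \<in> tangent_S2 y" "W \<in> tangent_S2 y" and l: "\<bar>l\<bar> \<le> \<Lambda>"
        and s: "norm U + norm W \<le> ?\<rho>" for y U W l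
    proof -
      have gt: "-1 < arc_cos U W" "-1 < end_cos U W l"
        using \<rho>1(2)[OF l, of U W] s by auto
      define a b where "a = ?a (U, W, l) - (\<Sum>k<n. g k (U, W, l))"
        and "b = ?b (U, W, l) - (\<Sum>k<n. h k (U, W, l))"
      let ?s = "norm U + norm W"
      have "\<bar>a\<bar> \<le> C2 * ?s ^ (2 * n)" "\<bar>b\<bar> \<le> C3 * ?s ^ (2 * n)"
        unfolding a_def b_def using s by (intro \<rho>2(3)[OF l, of U W] \<rho>3(3)[OF l, of U W]; simp)+
      have "G_S2 y U W l - (\<Sum>k<n. g k (U, W, l) *\<^sub>R U + h k (U, W, l) *\<^sub>R W) = a *\<^sub>R U + b *\<^sub>R W"
        using G_S2_eq(2)[OF y gt]
        by (simp add: a_def b_def sum.distrib scaleR_sum_left[symmetric] scaleR_diff_left)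
      also have "norm \<dots> \<le> \<bar>a\<bar> * norm U + \<bar>b\<bar> * norm W"
        by (intro norm_triangle_le) simp
      also have "\<dots> \<le> (C2 * ?s ^ (2 * n)) * ?s + (C3 * ?s ^ (2 * n)) * ?s"
        using \<open>\<bar>a\<bar> \<le> _\<close> \<open>\<bar>b\<bar> \<le> _\<close> \<rho>2(2) \<rho>3(2) by (intro add_mono mult_mono) simp_all
      also have "\<dots> = (C2 + C3) * ?s ^ (2 * n + 1)"
        by (simp add: algebra_simps)
      finally show ?thesis using G_S2_eq(1)[OF y gt] by blast
    qed
    moreover have "?\<rho> > 0" "C2 + C3 > 0" using \<rho>1 \<rho>2 \<rho>3 by auto
    ultimately show ?thesis by blast
  qed
  moreover have "g 0 (U, W, l) = 1 - l" "h 0 (U, W, l) = l" for U W l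
    using graded_constant_term[OF g n] graded_constant_term[OF h n] by simp_all
  ultimately show ?thesis using g(1) h(1) that by blast
qed

section \<open>Absence of a quadratic term\<close>

lemma tangent_S2_scaleR: "U \<in> tangent_S2 y \<Longrightarrow> t *\<^sub>R U \<in> tangent_S2 y"
  by (simp add: tangent_S2_def)

text \<open>Replacing \<open>(U, W)\<close> by \<open>(t U, t W)\<close> and cancelling
  \<open>t ^ r\<close> leaves a bound proportional to \<open>t\<close>, which tends to 0.\<close>

lemma homogeneous_at_eq_0:
  assumes hom: "homogeneous_at r y Q" and U: "U \<in> tangent_S2 y" and W: "W \<in> tangent_S2 y" and "\<rho> > 0"
    and bound: "\<And>U W. U \<in> tangent_S2 y \<Longrightarrow> W \<in> tangent_S2 y \<Longrightarrow> norm U + norm W \<le> \<rho> \<Longrightarrow>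
      norm (Q U W) \<le> C * (norm U + norm W) ^ Suc r"
  shows "Q U W = 0"
proof (rule ccontr)
  assume nz: "Q U W \<noteq> 0"
  let ?s = "norm U + norm W"
  have le: "norm (Q U W) \<le> C * ?s ^ Suc r * t" if t: "t > 0" "t * ?s \<le> \<rho>" for t
  proof -
    have "norm (t *\<^sub>R U) + norm (t *\<^sub>R W) = t * ?s"
      using t by (simp add: algebra_simps)
    then have "norm (Q (t *\<^sub>R U) (t *\<^sub>R W)) \<le> C * (t * ?s) ^ Suc r"
      using bound[of "t *\<^sub>R U" "t *\<^sub>R W"] t U W by (simp add: tangent_S2_scaleR)
    moreover have "Q (t *\<^sub>R U) (t *\<^sub>R W) = t ^ r *\<^sub>R Q U W"
      using hom U W by (simp add: homogeneous_at_def)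
    ultimately have "t ^ r * norm (Q U W) \<le> t ^ r * (C * ?s ^ Suc r * t)"
      using t by (simp add: power_mult_distrib mult_ac)
    then show ?thesis using t by simp
  qed
  have "eventually (\<lambda>t. t * ?s \<le> \<rho>) (at_right 0)"
  proof -
    have "((\<lambda>t. t * ?s) \<longlongrightarrow> 0 * ?s) (at_right 0)" by (intro tendsto_intros)
    from order_tendstoD(2)[OF this, of \<rho>] \<open>\<rho> > 0\<close> show ?thesis
      by (auto elim: eventually_mono)
  qed
  then have "eventually (\<lambda>t. norm (Q U W) \<le> C * ?s ^ Suc r * t) (at_right 0)"
    using eventually_at_right_less[of 0] by eventually_elim (rule le)
  moreover have "((\<lambda>t. C * ?s ^ Suc r * t) \<longlongrightarrow> C * ?s ^ Suc r * 0) (at_right 0)"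
    by (intro tendsto_intros)
  ultimately have "norm (Q U W) \<le> 0"
    by (intro tendsto_lowerbound[of "\<lambda>t. C * ?s ^ Suc r * t" _ "at_right 0"]) (auto simp: mult_ac)
  then show False using nz by simp
qed

text \<open>The expansion with \<open>n = 1\<close> has the linear part and a cubic error.
  Comparison with a candidate \<open>Q\<close> makes \<open>Q\<close> of cubic size, which degree 2
  permits only for zero.\<close>

lemma quadratic_term_iff:
  assumes y: "y \<in> S2"
  shows "quadratic_term y l Q \<longleftrightarrow> (\<forall>U\<in>tangent_S2 y. \<forall>W\<in>tangent_S2 y. Q U W = 0)"
proof -
  obtain g h :: "nat \<Rightarrow> param \<Rightarrow> real" where gh: "\<And>U W l. g 0 (U, W, l) = 1 - l" "\<And>U W l. h 0 (U, W, l) = l"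
    "\<And>\<Lambda>. \<exists>\<rho>>0. \<exists>C>0. \<forall>y\<in>S2. \<forall>U\<in>tangent_S2 y. \<forall>W\<in>tangent_S2 y. \<forall>l.
      \<bar>l\<bar> \<le> \<Lambda> \<longrightarrow> norm U + norm W \<le> \<rho> \<longrightarrow> G_S2_defined y U W l \<and>
      norm (G_S2 y U W l - (\<Sum>k<1. g k (U, W, l) *\<^sub>R U + h k (U, W, l) *\<^sub>R W))
        \<le> C * (norm U + norm W) ^ (2 * 1 + 1)"
    by (rule G_S2_expansion[of 1]) (simp, rule that)
  have first_order: "(\<Sum>k<1::nat. g k (U, W, l) *\<^sub>R U + h k (U, W, l) *\<^sub>R W) = (1 - l) *\<^sub>R U + l *\<^sub>R W"
    for U W l by (simp add: gh(1,2))
  have three: "2 * 1 + 1 = (3 :: nat)" by simp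
  obtain \<rho> C where \<rho>: "\<rho> > 0" and C: "\<And>U W. U \<in> tangent_S2 y \<Longrightarrow> W \<in> tangent_S2 y \<Longrightarrow>
      norm U + norm W \<le> \<rho> \<Longrightarrow>
      norm (G_S2 y U W l - ((1 - l) *\<^sub>R U + l *\<^sub>R W)) \<le> C * (norm U + norm W) ^ 3"
    using gh(3)[of "\<bar>l\<bar>", unfolded first_order three] y by (blast intro: order_refl)
  show ?thesis
  proof
    assume zero: "\<forall>U\<in>tangent_S2 y. \<forall>W\<in>tangent_S2 y. Q U W = 0"
    then have "homogeneous_at 2 y Q"
      by (simp add: homogeneous_at_def tangent_S2_scaleR)
    then show "quadratic_term y l Q"
      unfolding quadratic_term_def using \<rho> C zero by (intro conjI exI[of _ \<rho>] exI[of _ C]) auto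
  next
    assume "quadratic_term y l Q"
    then obtain \<rho>' C' where hom: "homogeneous_at 2 y Q" and \<rho>': "\<rho>' > 0"
      and C': "\<And>U W. U \<in> tangent_S2 y \<Longrightarrow> W \<in> tangent_S2 y \<Longrightarrow> norm U + norm W \<le> \<rho>' \<Longrightarrow>
        norm (G_S2 y U W l - ((1 - l) *\<^sub>R U + l *\<^sub>R W + Q U W)) \<le> C' * (norm U + norm W) ^ 3"
      unfolding quadratic_term_def by blast
    have "norm (Q U W) \<le> (C + C') * (norm U + norm W) ^ Suc 2"
      if UW: "U \<in> tangent_S2 y" "W \<in> tangent_S2 y" "norm U + norm W \<le> min \<rho> \<rho>'" for U W
    proof -
      let ?L = "(1 - l) *\<^sub>R U + l *\<^sub>R W"
      have "Q U W = (G_S2 y U W l - ?L) - (G_S2 y U W l - (?L + Q U W))" by simp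
      also have "norm \<dots> \<le> norm (G_S2 y U W l - ?L) + norm (G_S2 y U W l - (?L + Q U W))"
        by (rule norm_triangle_ineq4)
      also have "\<dots> \<le> C * (norm U + norm W) ^ 3 + C' * (norm U + norm W) ^ 3"
        using C[OF UW(1,2)] C'[OF UW(1,2)] UW(3) by (intro add_mono) auto
      finally show ?thesis by (simp add: algebra_simps numeral_3_eq_3 numeral_2_eq_2)
    qed
    with homogeneous_at_eq_0[OF hom _ _ _ this, of _ _ "min \<rho> \<rho>'"] \<rho> \<rho>'
    show "\<forall>U\<in>tangent_S2 y. \<forall>W\<in>tangent_S2 y. Q U W = 0" by simp
  qed
qed

section \<open>Smoothness of the terms and assembly of the expansion\<close>

text \<open>The formula is polynomial on the whole ambient space, so it serves as its own smooth
  extension.\<close>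

lemma smooth_on_homog_poly_combination:
  assumes "homog_poly j g" "homog_poly k h"
  shows "smooth_on A (\<lambda>(y :: real^3, U, W, l). g (U, W, l) *\<^sub>R U + h (U, W, l) *\<^sub>R W)"
proof -
  have lin: "polynomial_function (f \<circ> snd)" if "bounded_linear f"
    for f :: "param \<Rightarrow> real^3"
    using that unfolding o_def
    by (intro polynomial_function_bounded_linear bounded_linear_compose[OF that bounded_linear_snd])
  have poly: "polynomial_function (\<lambda>x :: (real^3) \<times> param. f (snd x))"
    if "homog_poly i f" for i f
    using that real_polynomial_function_compose[of "snd :: (real^3) \<times> param \<Rightarrow> param" f]
    by (simp add: homog_poly_def o_def real_polynomial_function_eq[symmetric]
        polynomial_function_bounded_linear bounded_linear_snd)
  have "polynomial_function (\<lambda>x :: (real^3) \<times> param.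
      g (snd x) *\<^sub>R ((\<lambda>(U, W, l). U) \<circ> snd) x + h (snd x) *\<^sub>R ((\<lambda>(U, W, l). W) \<circ> snd) x)"
    by (intro polynomial_function_add polynomial_function_mult poly[OF assms(1)] poly[OF assms(2)]
        lin bounded_linear_param_components)
  then show ?thesis
    using smooth_on_polynomial_function by (simp add: split_def o_def)
qed

theorem lemma2:
  fixes M :: nat and K :: "(real^3) set"
  assumes "M \<ge> 1" and "compact K" and "K \<subseteq> S2"
  shows "\<exists>(\<G> :: nat \<Rightarrow> real^3 \<Rightarrow> real^3 \<Rightarrow> real^3 \<Rightarrow> real \<Rightarrow> real^3)
          (\<R> :: real^3 \<Rightarrow> real^3 \<Rightarrow> real^3 \<Rightarrow> real \<Rightarrow> real^3).
     (\<forall>r\<in>{3..M}.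
        (\<forall>y\<in>S2. \<forall>l. homogeneous_at r y (\<lambda>U W. \<G> r y U W l)) \<and>
        smooth_on tangent_pairs (\<lambda>(y, U, W, l). \<G> r y U W l)) \<and>
     (\<forall>I :: real set. is_interval I \<and> bounded I \<longrightarrow>
        (\<exists>\<rho>\<^sub>0>0. \<exists>C\<^sub>M>0. \<forall>y\<in>K. \<forall>U\<in>tangent_S2 y. \<forall>W\<in>tangent_S2 y. \<forall>l\<in>I.
           norm U + norm W \<le> \<rho>\<^sub>0 \<longrightarrow>
             G_S2_defined y U W l \<and>
             G_S2 y U W l =
               (1 - l) *\<^sub>R U + l *\<^sub>R W + (\<Sum>r=3..M. \<G> r y U W l) + \<R> y U W l \<and>
             norm (\<R> y U W l) \<le> C\<^sub>M * (norm U + norm W) ^ (M + 1))) \<and>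
     (\<forall>y\<in>K. \<forall>l. \<forall>Q. quadratic_term y l Q \<longleftrightarrow>
        (\<forall>U\<in>tangent_S2 y. \<forall>W\<in>tangent_S2 y. Q U W = 0))"
proof -
  \<comment> \<open>The indices \<open>k < n\<close> give exactly the odd degrees
    \<open>2 * k + 1\<close> up to \<open>M\<close>. The error exponent \<open>2 * n + 1\<close> is
    \<open>M + 1\<close> for even \<open>M\<close> and \<open>M + 2\<close> for odd
    \<open>M\<close>.\<close>
  define n where "n = (M + 1) div 2"
  have n: "n \<ge> 1" "M + 1 \<le> 2 * n + 1" using assms(1) by (simp_all add: n_def)
  obtain g h where g: "\<And>k. homog_poly k (g k)" and h: "\<And>k. homog_poly k (h k)"
    and g0: "\<And>U W l. g 0 (U, W, l) = 1 - l" and h0: "\<And>U W l. h 0 (U, W, l) = l"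
    and G: "\<And>\<Lambda>. \<exists>\<rho>>0. \<exists>C>0. \<forall>y\<in>S2. \<forall>U\<in>tangent_S2 y. \<forall>W\<in>tangent_S2 y. \<forall>l.
      \<bar>l\<bar> \<le> \<Lambda> \<longrightarrow> norm U + norm W \<le> \<rho> \<longrightarrow> G_S2_defined y U W l \<and>
      norm (G_S2 y U W l - (\<Sum>k<n. g k (U, W, l) *\<^sub>R U + h k (U, W, l) *\<^sub>R W))
        \<le> C * (norm U + norm W) ^ (2 * n + 1)"
    using G_S2_expansion[OF n(1)] by blast
  define T where "T k y U W l = g k (U, W, l) *\<^sub>R U + h k (U, W, l) *\<^sub>R W"
    for k and y U W :: "real^3" and l
  define \<G> where "\<G> r y U W l = (if odd r then T (r div 2) y U W l else 0)"
    for r and y U W :: "real^3" and l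
  define \<R> where "\<R> y U W l = G_S2 y U W l - (\<Sum>k<n. T k y U W l)" for y U W l
  have sum: "(\<Sum>k<n. T k y U W l) = (1 - l) *\<^sub>R U + l *\<^sub>R W + (\<Sum>r=3..M. \<G> r y U W l)" for y U W l
  proof -
    have "(\<Sum>r=3..M. \<G> r y U W l) = (\<Sum>r\<in>{r\<in>{3..M}. odd r}. T (r div 2) y U W l)"
      unfolding \<G>_def by (rule sum.inter_filter[symmetric]) simp
    \<comment> \<open>Reindexing by \<open>r = 2 * k + 1\<close>; the missing index
      \<open>k = 0\<close> is the linear part, which is restored next.\<close>
    also have "\<dots> = (\<Sum>k\<in>{1..<n}. T k y U W l)"
      by (rule sum.reindex_bij_witness[of _ "\<lambda>k. 2 * k + 1" "\<lambda>r. r div 2"])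
        (auto simp: n_def elim!: oddE)
    finally have "(\<Sum>r=3..M. \<G> r y U W l) = (\<Sum>k\<in>{1..<n}. T k y U W l)" .
    moreover have "{..<n} = insert 0 {1..<n}" using n by auto
    ultimately show ?thesis by (simp add: T_def g0 h0)
  qed
  have hom: "homogeneous_at r y (\<lambda>U W. \<G> r y U W l)" for r y l
  proof (cases "odd r")
    case True
    then show ?thesis
      by (auto simp: homogeneous_at_def \<G>_def T_def homog_polyD[OF g] homog_polyD[OF h]
          scaleR_add_right mult_ac elim!: oddE)
  qed (simp add: homogeneous_at_def \<G>_def)
  have smooth: "smooth_on tangent_pairs (\<lambda>(y, U, W, l). \<G> r y U W l)" for r
  proof (cases "odd r")
    case True
    then show ?thesis
      using smooth_on_homog_poly_combination[OF g h] by (simp add: \<G>_def T_def)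
  next
    case False
    then show ?thesis
      using smooth_on_polynomial_function[OF polynomial_function_const, of _ 0]
      by (simp add: \<G>_def split_def)
  qed
  have expansion: "\<exists>\<rho>\<^sub>0>0. \<exists>C\<^sub>M>0. \<forall>y\<in>K. \<forall>U\<in>tangent_S2 y. \<forall>W\<in>tangent_S2 y. \<forall>l\<in>I.
      norm U + norm W \<le> \<rho>\<^sub>0 \<longrightarrow> G_S2_defined y U W l \<and>
      G_S2 y U W l = (1 - l) *\<^sub>R U + l *\<^sub>R W + (\<Sum>r=3..M. \<G> r y U W l) + \<R> y U W l \<and>
      norm (\<R> y U W l) \<le> C\<^sub>M * (norm U + norm W) ^ (M + 1)"
    if I: "bounded I" for I :: "real set"
  proof -
    obtain \<Lambda> where \<Lambda>: "\<And>l. l \<in> I \<Longrightarrow> \<bar>l\<bar> \<le> \<Lambda>"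
      using I unfolding bounded_iff real_norm_def by blast
    obtain \<rho> C where "\<rho> > 0" "C > 0" and bound: "\<And>y U W l. y \<in> S2 \<Longrightarrow> U \<in> tangent_S2 y \<Longrightarrow>
        W \<in> tangent_S2 y \<Longrightarrow> \<bar>l\<bar> \<le> \<Lambda> \<Longrightarrow> norm U + norm W \<le> \<rho> \<Longrightarrow> G_S2_defined y U W l \<and>
        norm (\<R> y U W l) \<le> C * (norm U + norm W) ^ (2 * n + 1)"
      using G[of \<Lambda>] unfolding \<R>_def T_def by blast
    have "G_S2_defined y U W l \<and>
        G_S2 y U W l = (1 - l) *\<^sub>R U + l *\<^sub>R W + (\<Sum>r=3..M. \<G> r y U W l) + \<R> y U W l \<and>
        norm (\<R> y U W l) \<le> C * (norm U + norm W) ^ (M + 1)"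
      if "y \<in> K" "U \<in> tangent_S2 y" "W \<in> tangent_S2 y" "l \<in> I" "norm U + norm W \<le> min \<rho> 1"
      for y U W l
    proof -
      have *: "G_S2_defined y U W l \<and> norm (\<R> y U W l) \<le> C * (norm U + norm W) ^ (2 * n + 1)"
        using that assms(3) by (intro bound \<Lambda>) auto
      \<comment> \<open>The radius was capped at 1 so that the exponent may be lowered.\<close>
      have "(norm U + norm W) ^ (2 * n + 1) \<le> (norm U + norm W) ^ (M + 1)"
        using n(2) that(5) by (intro power_decreasing) auto
      then have "C * (norm U + norm W) ^ (2 * n + 1) \<le> C * (norm U + norm W) ^ (M + 1)"
        using \<open>C > 0\<close> by (intro mult_left_mono) auto
      then show ?thesis
        using * sum[of y U W l, symmetric] by (auto simp: \<R>_def)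
    qed
    with \<open>\<rho> > 0\<close> \<open>C > 0\<close> show ?thesis
      by (intro exI[of _ "min \<rho> 1"] exI[of _ C]) auto
  qed
  have quadratic: "\<forall>y\<in>K. \<forall>l. \<forall>Q. quadratic_term y l Q \<longleftrightarrow>
      (\<forall>U\<in>tangent_S2 y. \<forall>W\<in>tangent_S2 y. Q U W = 0)"
    using quadratic_term_iff assms(3) by blast
  show ?thesis
    by (rule exI[of _ \<G>], rule exI[of _ \<R>]) (use hom smooth expansion quadratic in blast)
qed

end
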